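(* Let $\sigma^2>0$, let $\nu$ be a probability distribution supported on an ellipsoid $\{\theta\in\mathbb{R}^d:\|A\theta\|_2=1\}$ ($A$ symmetric positive semi-definite), $H=\mathbb{E}_\nu[\theta\theta^\top]$, $\tilde X=H^{1/2}X$, $\Sigma_H=H^{1/2}\Sigma H^{1/2}$, and assume there is $L_H>0$ with $\mathbb{E}[\|\tilde X\|_2^2\,\tilde X\tilde X^\top]\preceq L_H^2\Sigma_H$. Then $$C_{\sigma,L_H}\,\frac{\sigma^2}{n}\,\mathrm{df}_2(\Sigma_H;\lambda_{\sigma,L_H})\le\bar{\mathcal{E}}(\Sigma_H;\sigma^2)-\bar{\mathcal{E}}(\Sigma_H;0),$$ where: (i) if $L_H^2<\sigma^2$, one may take $C_{\sigma,L_H}=1-L_H^2/\sigma^2$ and $\lambda_{\sigma,L_H}=(\sigma^2+L_H^2)/n$; (ii) if $\|\tilde X\|_2^2\le L_H^2$ almost surely, one may take $C_{\sigma,L_H}=1/(1+L_H^2/\sigma^2)^2$ and $\lambda_{\sigma,L_H}=\sigma^2/n$.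
   Context: Setting: $(X,Y)\in\mathbb{R}^d\times\mathbb{R}$ satisfies $Y=X^\top\theta_\star+\epsilon$ with $\mathbb{E}[\epsilon\mid X]=0$, $\mathbb{E}[\epsilon^2\mid X]=\sigma^2$; $\Sigma=\mathbb{E}[XX^\top]$. Training data $(X_i,Y_i)_{i\in[n]}$ are i.i.d. copies of $(X,Y)$, independent of a test pair. A linear prediction rule is $\hat f(x)=\sum_{i=1}^n l_i(x)Y_i$ with each $l_i$ a (possibly random) function of $x$, $(X_i)_{i\in[n]}$ and independent randomness. $R(f)=\mathbb{E}[(Y-f(X))^2]$, $\mathcal{E}_{s}(\hat f)=\mathbb{E}[R(\hat f)]-s$ when the noise variance is $s$. $\bar{\mathcal{E}}(\Sigma_H;s)$ denotes $\inf_{\hat f}\mathbb{E}_{\theta_\star\sim\nu}[\mathcal{E}_{s}(\hat f)]$ for noise variance $s$ (infimum over linear prediction rules, $\theta_\star\sim\nu$ independent of the data); $\bar{\mathcal{E}}(\Sigma_H;0)$ is the same quantity for the noiseless model $\epsilon=0$. $\mathrm{df}_2(S;\lambda)=\mathrm{Tr}(S^2(S+\lambda I)^{-2})$. *)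

theory Defs
  imports "HOL-Probability.Probability"
begin

definition psd_mat :: "real^'d^'d \<Rightarrow> bool" where
  "psd_mat S \<longleftrightarrow> transpose S = S \<and> (\<forall>v. 0 \<le> v \<bullet> (S *v v))"

definition loewner_le :: "real^'d^'d \<Rightarrow> real^'d^'d \<Rightarrow> bool" where
  "loewner_le S T \<longleftrightarrow> transpose S = S \<and> psd_mat (T - S)"

definition psd_sqrt :: "real^'d^'d \<Rightarrow> real^'d^'d" where
  "psd_sqrt H = (THE S. psd_mat S \<and> S ** S = H)"

definition df2 :: "real^'d^'d \<Rightarrow> real \<Rightarrow> real" where
  "df2 S lam = trace (S ** S ** matrix_inv ((S + lam *\<^sub>R mat 1) ** (S + lam *\<^sub>R mat 1)))"

(*
  P is the joint law of (X, \<epsilon>); the response is Y = X\<^sup>T\<theta> + \<epsilon>.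
  A linear prediction rule with randomness space R (a probability space on 'r) is given by
  weights l i (x, (X_j)_{j<n}, u), i < n, jointly measurable; its prediction is
  f(x) = \<Sum>_{i<n} l_i(x,(X_j),u) Y_i.
  lin_risk n P R l \<theta> is E[R(f)] = E[(Y - f(X))^2], where the expectation is over the
  test pair, the n i.i.d. training pairs and the independent randomness u. *)

definition lin_risk ::
  "nat \<Rightarrow> ((real^'d) \<times> real) measure \<Rightarrow> 'r measure
     \<Rightarrow> (nat \<Rightarrow> ((real^'d) \<times> (nat \<Rightarrow> real^'d) \<times> 'r) \<Rightarrow> real) \<Rightarrow> real^'d \<Rightarrow> ennreal" where
  "lin_risk n P R l \<theta> =
     (\<integral>\<^sup>+ w. (case w of (z0, zs, u) \<Rightarrow>
        ennreal ((fst z0 \<bullet> \<theta> + snd z0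
          - (\<Sum>i<n. l i (fst z0, restrict (\<lambda>j. fst (zs j)) {..<n}, u)
                      * (fst (zs i) \<bullet> \<theta> + snd (zs i)))) ^ 2))
      \<partial>(pair_measure P (pair_measure (PiM {..<n} (\<lambda>_. P)) R)))"

definition linear_rules ::
  "nat \<Rightarrow> 'r measure \<Rightarrow> (nat \<Rightarrow> ((real^'d) \<times> (nat \<Rightarrow> real^'d) \<times> 'r) \<Rightarrow> real) set" where
  "linear_rules n R =
     {l. \<forall>i<n. l i \<in> borel_measurable
            (pair_measure (borel :: (real^'d) measure)
               (pair_measure (PiM {..<n} (\<lambda>_. (borel :: (real^'d) measure))) R))}"

(*Bayes excess risk over linear rules, \<theta>\<^sub>\<star> \<sim> \<nu> independent of the data, for noise
  variance s: inf over rules of E_\<nu>[E[R(f)]] - s  (an extended real).*)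
definition Ebar ::
  "'r itself \<Rightarrow> nat \<Rightarrow> ((real^'d) \<times> real) measure \<Rightarrow> (real^'d) measure \<Rightarrow> real \<Rightarrow> ereal" where
  "Ebar _ n P \<nu> s =
     (INF Rl \<in> {(R :: 'r measure, l). prob_space R \<and> l \<in> linear_rules n R}.
        enn2ereal (\<integral>\<^sup>+ \<theta>. lin_risk n P (fst Rl) (snd Rl) \<theta> \<partial>\<nu>)) - ereal s"

definition noiseless :: "((real^'d) \<times> real) measure \<Rightarrow> ((real^'d) \<times> real) measure" where
  "noiseless P = distr P borel (\<lambda>z. (fst z, 0))"

end

theory Submission
  imports Defs
begin

text \<open>
  Write \<open>x\<close>, \<open>x\<^sub>i\<close> for the vectors transformed by \<open>H\<^sup>1\<^sup>/\<^sup>2\<close>. Averaging over the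
  noise and over \<open>\<theta>\<close> turns the Bayes risk of a rule with weights \<open>l\<close> into
  \<open>E (\<bar>x - \<Sum> l\<^sub>i x\<^sub>i\<bar>\<^sup>2 + s \<bar>l\<bar>\<^sup>2) + s\<close>, whose integrand is minimised pointwise by the ridge
  weights \<open>l\<^sub>i = x\<^sub>i \<bullet> G x\<close> with \<open>G = (\<Sum> x\<^sub>i x\<^sub>i\<^sup>T + s I)\<^sup>-\<^sup>1\<close>. Using the same ridge weights in the
  noiseless problem shows that the gap is at least \<open>\<sigma>\<^sup>2 E \<bar>l\<bar>\<^sup>2\<close>.

  Along an eigenvector \<open>e\<close> of \<open>\<Sigma>\<^sub>H\<close> with eigenvalue \<open>d\<close>, compare ridge regression with the weights
  \<open>c (x\<^sub>i \<bullet> e)\<close>, where \<open>c = 1 / (n (d + \<lambda>))\<close> and \<open>\<lambda> = (\<sigma>\<^sup>2 + L\<^sup>2) / n\<close>. Their expected cost for the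
  target \<open>e\<close> is at most \<open>1 - d / (d + \<lambda>)\<close> by the fourth-moment assumption; by optimality of ridge
  regression and \<open>l\<^sup>2 \<ge> 2 l g - g\<^sup>2\<close> this gives \<open>E \<bar>l\<bar>\<^sup>2 \<ge> df\<^sub>2(\<Sigma>\<^sub>H; \<lambda>) / n\<close>. This bound implies both
  parts of the theorem, since \<open>d + \<lambda> \<le> (1 + L\<^sup>2/\<sigma>\<^sup>2) (d + \<sigma>\<^sup>2/n)\<close>.
\<close>

section \<open>Spectral decomposition and square roots of symmetric matrices\<close>

lemma symmetric_matrix_inner:
  fixes S :: "real^'d^'d"
  assumes "transpose S = S"
  shows "v \<bullet> (S *v w) = (S *v v) \<bullet> w"
  using dot_lmul_matrix[of v S w] assms by (metis transpose_matrix_vector)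

text \<open>Rayleigh quotient argument: the orthogonal complement of \<open>B\<close> is invariant
  under \<open>S\<close>, so a maximiser of \<open>v \<bullet> (S *v v)\<close> on its unit sphere
  is an eigenvector. Repeated use builds an eigenbasis one vector at a time.\<close>

lemma symmetric_eigenvector_orthogonal_to_eigenvectors:
  fixes S :: "real^'d^'d"
  assumes sym: "transpose S = S"
    and eig: "\<And>b. b \<in> B \<Longrightarrow> \<exists>d. S *v b = d *\<^sub>R b"
    and fin: "finite B" and card: "card B < CARD('d)"
  obtains w d where "norm w = 1" "\<And>b. b \<in> B \<Longrightarrow> w \<bullet> b = 0" "S *v w = d *\<^sub>R w"
proof -
  define V where "V = {v. \<forall>b\<in>B. v \<bullet> b = 0}"
  have V_alt: "V = (\<Inter>b\<in>B. {v. b \<bullet> v = 0})"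
    by (auto simp: V_def inner_commute)
  have subV: "subspace V"
    unfolding V_def by (auto simp: subspace_def inner_add_left)
  have clV: "closed V"
    unfolding V_alt by (intro closed_INT ballI closed_hyperplane)
  have invV: "S *v v \<in> V" if "v \<in> V" for v
    using that eig unfolding V_def
    by (auto simp: symmetric_matrix_inner[OF sym, symmetric]) (metis inner_scaleR_right mult_zero_right)
  \<comment> \<open>Fewer than \<open>CARD('d)\<close> vectors cannot span the space, so a nonzero
    \<open>a\<close> orthogonal to all of \<open>B\<close> exists; it makes the unit sphere of
    \<open>V\<close> nonempty.\<close>
  have "dim (span B) < DIM(real^'d)"
    using dim_le_card'[OF fin] card by simp
  then obtain a where a: "a \<noteq> 0" "\<And>x. x \<in> span B \<Longrightarrow> orthogonal a x"
    using orthogonal_to_subspace_exists_gen[of "span B" UNIV]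
    by (metis dim_UNIV dim_span orthogonal_to_subspace_exists)
  have aV: "a /\<^sub>R norm a \<in> V"
    using a by (auto simp: V_def orthogonal_def span_base)
  define K where "K = sphere 0 1 \<inter> V"
  have "compact K"
    unfolding K_def by (intro compact_Int_closed clV) auto
  moreover have "a /\<^sub>R norm a \<in> K"
    using aV a(1) by (simp add: K_def)
  then have "K \<noteq> {}"
    by blast
  moreover have "continuous_on K (\<lambda>v. v \<bullet> (S *v v))"
    by (intro continuous_intros matrix_vector_mult_linear_continuous_on)
  ultimately obtain w where w: "w \<in> K" "\<And>v. v \<in> K \<Longrightarrow> v \<bullet> (S *v v) \<le> w \<bullet> (S *v w)"
    using continuous_attains_sup[of K "\<lambda>v. v \<bullet> (S *v v)"] by blast
  define m where "m = w \<bullet> (S *v w)"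
  have wV: "w \<in> V" and nw: "norm w = 1"
    using w(1) by (auto simp: K_def)
  have le: "v \<bullet> (S *v v) \<le> m * (v \<bullet> v)" if "v \<in> V" for v
  proof (cases "v = 0")
    case False
    have "v /\<^sub>R norm v \<in> K"
      using that False subV by (auto simp: K_def subspace_def)
    from w(2)[OF this] False show ?thesis
      by (simp add: m_def matrix_vector_mult_scaleR divide_simps power2_norm_eq_inner[symmetric] power2_eq_square mult_ac)
  qed simp
  define g where "g = S *v w - m *\<^sub>R w"
  have gV: "g \<in> V"
    unfolding g_def using subV invV wV by (simp add: subspace_diff subspace_scale)
  define \<beta> where "\<beta> = g \<bullet> (S *v g) - m * (g \<bullet> g)"
  have gw: "w \<bullet> (S *v g) = (S *v w) \<bullet> g"
    by (rule symmetric_matrix_inner[OF sym])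
  \<comment> \<open>First variation at the maximiser: the residual \<open>g\<close> lies in
    \<open>V\<close>, so \<open>w + t *\<^sub>R g\<close> is admissible, and the part of the
    Rayleigh bound linear in \<open>t\<close> reduces to
    \<open>2 * t * (g \<bullet> g)\<close>.\<close>
  have quad: "2 * t * (g \<bullet> g) + t\<^sup>2 * \<beta> \<le> 0" for t :: real
  proof -
    have "w + t *\<^sub>R g \<in> V"
      using subV wV gV by (simp add: subspace_add subspace_scale)
    from le[OF this] have "(w + t *\<^sub>R g) \<bullet> (S *v (w + t *\<^sub>R g)) \<le> m * ((w + t *\<^sub>R g) \<bullet> (w + t *\<^sub>R g))" .
    moreover have "w \<bullet> w = 1"
      using nw by (simp add: power2_norm_eq_inner[symmetric])
    moreover have "(w + t *\<^sub>R g) \<bullet> (S *v (w + t *\<^sub>R g)) = m + 2 * t * ((S *v w) \<bullet> g) + t\<^sup>2 * (g \<bullet> (S *v g))"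
      using gw by (simp add: inner_add_left inner_add_right matrix_vector_right_distrib matrix_vector_mult_scaleR
          m_def[symmetric] inner_commute[of g "S *v w"] power2_eq_square algebra_simps)
    moreover have "(w + t *\<^sub>R g) \<bullet> (w + t *\<^sub>R g) = w \<bullet> w + 2 * t * (w \<bullet> g) + t\<^sup>2 * (g \<bullet> g)"
      by (simp add: inner_add_left inner_add_right inner_commute[of g w] power2_eq_square algebra_simps)
    ultimately have "m + 2 * t * ((S *v w) \<bullet> g) + t\<^sup>2 * (g \<bullet> (S *v g)) \<le> m * (1 + 2 * t * (w \<bullet> g) + t\<^sup>2 * (g \<bullet> g))"
      by metis
    then have "2 * t * ((S *v w) \<bullet> g - m * (w \<bullet> g)) + t\<^sup>2 * \<beta> \<le> 0"
      unfolding \<beta>_def by (simp add: algebra_simps)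
    moreover have "(S *v w) \<bullet> g - m * (w \<bullet> g) = g \<bullet> g"
      by (simp add: g_def inner_diff_left)
    ultimately show ?thesis by simp
  qed
  have "g \<bullet> g = 0"
  proof (rule ccontr)
    assume "g \<bullet> g \<noteq> 0"
    then have p: "g \<bullet> g > 0" by simp
    \<comment> \<open>With this \<open>t\<close> one has
      \<open>t * \<bar>\<beta>\<bar> \<le> g \<bullet> g\<close>, so the positive linear term beats
      the quadratic one and \<open>quad\<close> is violated.\<close>
    define t where "t = (g \<bullet> g) / (\<bar>\<beta>\<bar> + 1)"
    have t: "t > 0" using p by (simp add: t_def)
    have "t * \<bar>\<beta>\<bar> \<le> g \<bullet> g"
      using p by (simp add: t_def field_simps)
    then have "t * (t * \<bar>\<beta>\<bar>) \<le> t * (g \<bullet> g)"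
      using t by (intro mult_left_mono) auto
    moreover have "- (t * (t * \<bar>\<beta>\<bar>)) \<le> t * (t * \<beta>)"
      using t by (metis abs_ge_minus_self abs_mult abs_of_pos minus_le_iff)
    ultimately show False
      using quad[of t] t p mult_pos_pos[OF t p] unfolding power2_eq_square mult.assoc by linarith
  qed
  then have "S *v w = m *\<^sub>R w"
    by (simp add: g_def)
  then show thesis
    using that nw wV by (auto simp: V_def)
qed

text \<open>Indexing by the coordinate type makes the vectors the rows of a square matrix
  \<open>\<chi> i. e i\<close>, so that orthonormality is orthogonality of this matrix.\<close>

definition eigenbasis :: "real^'d^'d \<Rightarrow> ('d \<Rightarrow> real^'d) \<Rightarrow> ('d \<Rightarrow> real) \<Rightarrow> bool" where
  "eigenbasis S e d \<longleftrightarrow>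
     (\<forall>i j. e i \<bullet> e j = (if i = j then 1 else 0)) \<and> (\<forall>i. S *v e i = d i *\<^sub>R e i)"

text \<open>Orthonormal sets of eigenvectors are enlarged one vector at a time up to size
  \<open>CARD('d)\<close> and then re-indexed by the coordinate type through a bijection.\<close>

lemma eigenbasis_exists:
  fixes S :: "real^'d^'d"
  assumes sym: "transpose S = S"
  obtains e d where "eigenbasis S e d"
proof -
  have "\<exists>B. finite B \<and> card B = k \<and> (\<forall>b\<in>B. norm b = 1 \<and> (\<exists>d. S *v b = d *\<^sub>R b)) \<and>
      (\<forall>b\<in>B. \<forall>c\<in>B. b \<noteq> c \<longrightarrow> b \<bullet> c = 0)" if "k \<le> CARD('d)" for k
    using that
  proof (induction k)
    case 0
    show ?case by (intro exI[of _ "{}"]) auto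
  next
    case (Suc k)
    then obtain B where B: "finite B" "card B = k" "\<forall>b\<in>B. norm b = 1 \<and> (\<exists>d. S *v b = d *\<^sub>R b)"
      "\<forall>b\<in>B. \<forall>c\<in>B. b \<noteq> c \<longrightarrow> b \<bullet> c = 0" by auto
    obtain w d where w: "norm w = 1" "\<And>b. b \<in> B \<Longrightarrow> w \<bullet> b = 0" "S *v w = d *\<^sub>R w"
      using symmetric_eigenvector_orthogonal_to_eigenvectors[OF sym, of B] B Suc.prems
      by (metis Suc_le_lessD)
    have "w \<notin> B"
      using w(1,2) by force
    then show ?case
      using B w by (intro exI[of _ "insert w B"]) (auto simp: inner_commute)
  qed
  from this[OF order_refl] obtain B where B: "finite B" "card B = CARD('d)"
    "\<And>b. b \<in> B \<Longrightarrow> norm b = 1 \<and> (\<exists>d. S *v b = d *\<^sub>R b)"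
    "\<And>b c. b \<in> B \<Longrightarrow> c \<in> B \<Longrightarrow> b \<noteq> c \<Longrightarrow> b \<bullet> c = 0"
    by auto
  obtain e where e: "bij_betw e (UNIV :: 'd set) B"
    using finite_same_card_bij[of "UNIV :: 'd set" B] B by auto
  then have eB: "e i \<in> B" for i
    by (auto simp: bij_betw_def)
  then have "\<forall>i. \<exists>d. S *v e i = d *\<^sub>R e i"
    using B(3) by blast
  then obtain d where "\<And>i. S *v e i = d i *\<^sub>R e i"
    unfolding choice_iff by blast
  moreover have "e i \<bullet> e j = (if i = j then 1 else 0)" for i j
    using B(3)[OF eB[of i]] B(4)[OF eB[of i] eB[of j]] e
    by (auto simp: bij_betw_def inj_eq power2_norm_eq_inner[symmetric])
  ultimately show thesis
    using that[of e d] unfolding eigenbasis_def by simp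
qed

text \<open>The first identity is orthonormality of the rows. The second, which expresses
  completeness, follows because a one-sided inverse of a square matrix is two-sided.\<close>

lemma eigenbasis_orthonormal:
  assumes "eigenbasis S e d"
  shows "(\<chi> i. e i) ** transpose (\<chi> i. e i) = mat 1"
    and "transpose (\<chi> i. e i) ** (\<chi> i. e i) = mat 1"
proof -
  show *: "(\<chi> i. e i) ** transpose (\<chi> i. e i) = mat 1"
    using assms
    by (auto simp: eigenbasis_def vec_eq_iff matrix_matrix_mult_def transpose_def mat_def inner_vec_def)
  show "transpose (\<chi> i. e i) ** (\<chi> i. e i) = mat 1"
    using * matrix_left_right_inverse by blast
qed

lemma eigenbasis_expansion:
  fixes S :: "real^'d^'d"
  assumes "eigenbasis S e d"
  shows "v = (\<Sum>i\<in>UNIV. (v \<bullet> e i) *\<^sub>R e i)"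
proof -
  have "v = transpose (\<chi> i. e i) *v ((\<chi> i. e i) *v v)"
    using eigenbasis_orthonormal(2)[OF assms] by (simp add: matrix_vector_mul_assoc)
  also have "\<dots> = (\<Sum>i\<in>UNIV. (v \<bullet> e i) *\<^sub>R e i)"
    by (simp add: vec_eq_iff matrix_vector_mult_def transpose_def inner_vec_def mult.commute)
  finally show ?thesis .
qed

lemma eigenbasis_matrix_eqI:
  fixes S T U :: "real^'d^'d"
  assumes "eigenbasis S e d" "\<And>i. T *v e i = U *v e i"
  shows "T = U"
proof -
  have "T *v v = U *v v" for v
  proof -
    have "T *v (\<Sum>i\<in>UNIV. (v \<bullet> e i) *\<^sub>R e i) = U *v (\<Sum>i\<in>UNIV. (v \<bullet> e i) *\<^sub>R e i)"
      using assms(2) by (simp add: linear_sum matrix_vector_mult_scaleR linear_cmul)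
    then show ?thesis
      using eigenbasis_expansion[OF assms(1), of v] by simp
  qed
  then show ?thesis
    by (simp add: matrix_eq)
qed

text \<open>Cyclicity of the trace: conjugating \<open>T\<close> by the orthogonal matrix of
  eigenvectors leaves the trace unchanged and puts the terms \<open>e i \<bullet> (T *v e i)\<close>
  on the diagonal.\<close>

lemma eigenbasis_trace:
  fixes S T :: "real^'d^'d"
  assumes "eigenbasis S e d"
  shows "trace T = (\<Sum>i\<in>UNIV. e i \<bullet> (T *v e i))"
proof -
  let ?Q = "\<chi> i. e i"
  have "trace T = trace (T ** (transpose ?Q ** ?Q))"
    by (simp add: eigenbasis_orthonormal(2)[OF assms])
  also have "\<dots> = trace (?Q ** (T ** transpose ?Q))"
    using trace_mul_sym[of "T ** transpose ?Q" ?Q] by (simp add: matrix_mul_assoc)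
  also have "\<dots> = (\<Sum>i\<in>UNIV. e i \<bullet> (T *v e i))"
    by (simp add: trace_def matrix_matrix_mult_def matrix_vector_mult_def transpose_def inner_vec_def)
  finally show ?thesis .
qed

lemma eigenbasis_quadratic_form:
  fixes S :: "real^'d^'d"
  assumes "eigenbasis S e d"
  shows "v \<bullet> (S *v v) = (\<Sum>i\<in>UNIV. d i * (v \<bullet> e i)\<^sup>2)"
proof -
  have "S *v v = S *v (\<Sum>i\<in>UNIV. (v \<bullet> e i) *\<^sub>R e i)"
    using eigenbasis_expansion[OF assms, of v] by simp
  also have "\<dots> = (\<Sum>i\<in>UNIV. (v \<bullet> e i) *\<^sub>R d i *\<^sub>R e i)"
    using assms by (simp add: linear_sum matrix_vector_mult_scaleR eigenbasis_def)
  finally show ?thesis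
    by (simp add: inner_sum_right power2_eq_square mult_ac)
qed

lemma eigenbasis_psd_nonneg:
  assumes "eigenbasis S e d" "psd_mat S"
  shows "0 \<le> d i"
proof -
  have "0 \<le> e i \<bullet> (S *v e i)"
    using assms(2) by (simp add: psd_mat_def)
  then show ?thesis
    using assms(1) by (simp add: eigenbasis_def)
qed

text \<open>The defect \<open>w = T *v e i - sqrt (d i) *\<^sub>R e i\<close> satisfies
  \<open>T *v w = - sqrt (d i) *\<^sub>R w\<close>, which positivity of \<open>T\<close> forbids for
  nonzero \<open>w\<close> when \<open>d i > 0\<close>. For \<open>d i = 0\<close> the squared
  length of \<open>T *v e i\<close> is zero directly. Hence a positive root is determined on an
  eigenbasis, which is its uniqueness.\<close>

lemma psd_square_root_eigenvector:
  fixes T H :: "real^'d^'d"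
  assumes T: "psd_mat T" "T ** T = H" and e: "eigenbasis H e d" and d: "0 \<le> d i"
  shows "T *v e i = sqrt (d i) *\<^sub>R e i"
proof -
  define w where "w = T *v e i - sqrt (d i) *\<^sub>R e i"
  have sym: "transpose T = T" and pos: "\<And>v. 0 \<le> v \<bullet> (T *v v)"
    using T(1) by (auto simp: psd_mat_def)
  have TT: "T *v (T *v e i) = d i *\<^sub>R e i"
    using T(2) e by (simp add: matrix_vector_mul_assoc eigenbasis_def)
  have Tw: "T *v w = - sqrt (d i) *\<^sub>R w"
    using d by (simp add: w_def TT matrix_vector_mult_diff_distrib matrix_vector_mult_scaleR algebra_simps)
  have "w = 0"
  proof (cases "d i = 0")
    case True
    have "(T *v e i) \<bullet> (T *v e i) = e i \<bullet> (T *v (T *v e i))"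
      by (simp add: symmetric_matrix_inner[OF sym])
    then show ?thesis
      using True TT by (simp add: w_def)
  next
    case False
    then have "0 < sqrt (d i)"
      using d by simp
    moreover have "sqrt (d i) * (w \<bullet> w) \<le> 0"
      using pos[of w] by (simp add: Tw)
    ultimately have "w \<bullet> w \<le> 0"
      by (simp add: mult_le_0_iff)
    then show ?thesis
      by (metis inner_eq_zero_iff inner_ge_zero order_antisym)
  qed
  then show ?thesis
    by (simp add: w_def)
qed

text \<open>Existence comes from the spectral matrix \<open>R\<close>, the sum of
  \<open>sqrt (d i)\<close> times the projections onto \<open>e i\<close>; uniqueness comes from the
  action on eigenvectors. Both are required to unfold the definite description.\<close>

lemma psd_sqrt:
  fixes H :: "real^'d^'d"
  assumes H: "psd_mat H"
  shows "psd_mat (psd_sqrt H)" "psd_sqrt H ** psd_sqrt H = H"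
proof -
  obtain e d where e: "eigenbasis H e d"
    using eigenbasis_exists H unfolding psd_mat_def by metis
  have d: "0 \<le> d i" for i
    by (rule eigenbasis_psd_nonneg[OF e H])
  define R :: "real^'d^'d" where "R = (\<chi> a b. \<Sum>i\<in>UNIV. sqrt (d i) * e i $ a * e i $ b)"
  have R: "R *v v = (\<Sum>i\<in>UNIV. (sqrt (d i) * (v \<bullet> e i)) *\<^sub>R e i)" for v
    unfolding R_def vec_eq_iff matrix_vector_mult_def
    by (simp add: inner_vec_def sum_distrib_left sum_distrib_right, intro allI, subst sum.swap)
       (simp add: mult_ac)
  have Re: "R *v e i = sqrt (d i) *\<^sub>R e i" for i
    using e by (simp add: R eigenbasis_def if_distrib[of "\<lambda>x. _ * x"] if_distrib[of "\<lambda>x. x *\<^sub>R _"] cong: if_cong)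
  have "transpose R = R"
    by (simp add: R_def transpose_def vec_eq_iff mult_ac)
  moreover have "0 \<le> v \<bullet> (R *v v)" for v
    by (auto simp: R inner_sum_right d mult.assoc intro!: sum_nonneg mult_nonneg_nonneg[of "sqrt _"])
  ultimately have "psd_mat R"
    by (simp add: psd_mat_def)
  moreover have "R ** R = H"
  proof (rule eigenbasis_matrix_eqI[OF e])
    show "(R ** R) *v e i = H *v e i" for i
      using e d by (simp add: matrix_vector_mul_assoc[symmetric] Re matrix_vector_mult_scaleR eigenbasis_def)
  qed
  moreover have "T = R" if "psd_mat T \<and> T ** T = H" for T
    using that psd_square_root_eigenvector[OF _ _ e d] by (intro eigenbasis_matrix_eqI[OF e]) (simp add: Re)
  ultimately have "psd_mat (psd_sqrt H) \<and> psd_sqrt H ** psd_sqrt H = H"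
    unfolding psd_sqrt_def by (intro theI[of "\<lambda>S. psd_mat S \<and> S ** S = H" R]) blast+
  then show "psd_mat (psd_sqrt H)" "psd_sqrt H ** psd_sqrt H = H" by auto
qed

section \<open>Inverse matrices and the effective dimension in spectral coordinates\<close>

lemma matrix_inv_mult_vector:
  fixes A :: "real^'d^'d"
  assumes "\<And>v. A *v v = 0 \<Longrightarrow> v = 0"
  shows "A *v (matrix_inv A *v x) = x" "matrix_inv A *v (A *v x) = x"
proof -
  have "invertible A"
    using assms matrix_left_invertible_ker[of A] invertible_left_inverse by blast
  then show "A *v (matrix_inv A *v x) = x" "matrix_inv A *v (A *v x) = x"
    using someI_ex[of "\<lambda>A'. A ** A' = mat 1 \<and> A' ** A = mat 1"]
    by (simp_all add: matrix_vector_mul_assoc matrix_inv_def invertible_def)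
qed

lemma df2_eigenbasis:
  fixes S :: "real^'d^'d"
  assumes e: "eigenbasis S e d" and d: "\<And>i. 0 \<le> d i" and lam: "lam > 0"
  shows "df2 S lam = (\<Sum>i\<in>UNIV. (d i)\<^sup>2 / (d i + lam)\<^sup>2)"
proof -
  let ?T = "(S + lam *\<^sub>R mat 1) ** (S + lam *\<^sub>R mat 1)"
  have nz: "d i + lam \<noteq> 0" for i
    using d[of i] lam by linarith
  have Se: "S *v e i = d i *\<^sub>R e i" for i
    using e by (simp add: eigenbasis_def)
  have Tv: "(S + lam *\<^sub>R mat 1) *v e i = (d i + lam) *\<^sub>R e i" for i
    by (simp add: matrix_vector_mult_add_rdistrib Se scaleR_matrix_vector_assoc[symmetric] scaleR_add_left)
  have Te: "?T *v e i = (d i + lam)\<^sup>2 *\<^sub>R e i" for i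
    by (simp only: matrix_vector_mul_assoc[symmetric] Tv matrix_vector_mult_scaleR scaleR_scaleR
        power2_eq_square)
  \<comment> \<open>\<open>G\<close> is the spectral candidate for the inverse. It serves to show
    that \<open>?T\<close> has trivial kernel; the action of \<open>matrix_inv ?T\<close> on
    eigenvectors is then read off from that of \<open>?T\<close>.\<close>
  define G :: "real^'d^'d" where "G = (\<chi> a b. \<Sum>i\<in>UNIV. 1 / (d i + lam)\<^sup>2 * e i $ a * e i $ b)"
  have G: "G *v v = (\<Sum>i\<in>UNIV. (1 / (d i + lam)\<^sup>2 * (v \<bullet> e i)) *\<^sub>R e i)" for v
    unfolding G_def vec_eq_iff matrix_vector_mult_def
    by (simp add: inner_vec_def sum_distrib_left sum_distrib_right sum_divide_distrib, intro allI, subst sum.swap)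
       (simp add: mult_ac)
  have Ge: "G *v e i = (1 / (d i + lam)\<^sup>2) *\<^sub>R e i" for i
    using e unfolding G
    by (simp add: eigenbasis_def if_distrib[of "\<lambda>x. x / _"] if_distrib[of "\<lambda>x. x *\<^sub>R _"] cong: if_cong)
  have "G ** ?T = mat 1"
    by (rule eigenbasis_matrix_eqI[OF e])
      (simp add: matrix_vector_mul_assoc[symmetric, of G] Te Ge matrix_vector_mult_scaleR nz del: matrix_vector_mul_assoc)
  then have inj: "v = 0" if "?T *v v = 0" for v
    using that matrix_left_invertible_ker[of ?T] by blast
  have inv: "matrix_inv ?T *v e i = (1 / (d i + lam)\<^sup>2) *\<^sub>R e i" for i
  proof -
    have "matrix_inv ?T *v (?T *v e i) = e i"
      by (rule matrix_inv_mult_vector(2)[OF inj])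
    then have "(d i + lam)\<^sup>2 *\<^sub>R (matrix_inv ?T *v e i) = e i"
      by (simp only: Te matrix_vector_mult_scaleR)
    then have "(1 / (d i + lam)\<^sup>2) *\<^sub>R (d i + lam)\<^sup>2 *\<^sub>R (matrix_inv ?T *v e i) = (1 / (d i + lam)\<^sup>2) *\<^sub>R e i"
      by (simp only:)
    then show ?thesis
      unfolding scaleR_scaleR using nz[of i] by simp
  qed
  have "e i \<bullet> ((S ** S ** matrix_inv ?T) *v e i) = (d i)\<^sup>2 / (d i + lam)\<^sup>2" for i
    using e unfolding matrix_vector_mul_assoc[symmetric] inv
    by (simp add: matrix_vector_mult_scaleR Se eigenbasis_def power2_eq_square)
  then show ?thesis
    by (simp only: df2_def eigenbasis_trace[OF e, of "S ** S ** matrix_inv ?T"])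
qed

text \<open>Termwise comparison based on
  \<open>d i + lam * (1 + a) \<le> (1 + a) * (d i + lam)\<close>. With \<open>lam\<close> =
  \<sigma>^2/n and \<open>a\<close> = L^2/\<sigma>^2 the shifted parameter is (\<sigma>^2 + L^2)/n,
  which produces the constant of part (ii).\<close>

lemma df2_shift_le:
  fixes S :: "real^'d^'d"
  assumes S: "psd_mat S" and lam: "lam > 0" and a: "a \<ge> 0"
  shows "1 / (1 + a)\<^sup>2 * df2 S lam \<le> df2 S (lam * (1 + a))"
proof -
  obtain e d where e: "eigenbasis S e d"
    using eigenbasis_exists S unfolding psd_mat_def by metis
  have d: "0 \<le> d i" for i
    by (rule eigenbasis_psd_nonneg[OF e S])
  have lam': "lam * (1 + a) > 0"
    using lam a by simp
  show ?thesis
    unfolding df2_eigenbasis[OF e d lam] df2_eigenbasis[OF e d lam'] sum_distrib_left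
  proof (rule sum_mono)
    fix i
    have "d i + lam * (1 + a) \<le> (1 + a) * (d i + lam)"
      using mult_nonneg_nonneg[OF a d[of i]] by (simp add: algebra_simps)
    then have "(d i + lam * (1 + a))\<^sup>2 \<le> ((1 + a) * (d i + lam))\<^sup>2"
      using d[of i] lam' by (intro power_mono) auto
    then have "(d i)\<^sup>2 / ((1 + a) * (d i + lam))\<^sup>2 \<le> (d i)\<^sup>2 / (d i + lam * (1 + a))\<^sup>2"
      using d[of i] lam' by (intro divide_left_mono mult_pos_pos) (auto simp: add_nonneg_pos a lam intro!: mult_pos_pos)
    then show "1 / (1 + a)\<^sup>2 * ((d i)\<^sup>2 / (d i + lam)\<^sup>2) \<le> (d i)\<^sup>2 / (d i + lam * (1 + a))\<^sup>2"
      by (simp add: power_mult_distrib)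
  qed
qed

lemma df2_nonneg:
  fixes S :: "real^'d^'d"
  assumes S: "psd_mat S" and lam: "lam > 0"
  shows "0 \<le> df2 S lam"
proof -
  obtain e d where e: "eigenbasis S e d"
    using eigenbasis_exists S unfolding psd_mat_def by metis
  show ?thesis
    by (subst df2_eigenbasis[OF e eigenbasis_psd_nonneg[OF e S] lam]) (auto intro!: sum_nonneg)
qed

section \<open>Ridge regression\<close>

text \<open>The unnormalised regularised sample second-moment matrix \<Sum> z z^T + s I. The
  entrywise form makes its measurability a matter of finite sums and products.\<close>

definition gram :: "nat \<Rightarrow> real \<Rightarrow> (nat \<Rightarrow> real^'d) \<Rightarrow> real^'d^'d" where
  "gram n s Z = (\<chi> a b. (\<Sum>i<n. Z i $ a * Z i $ b) + (if a = b then s else 0))"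

text \<open>Cramer's rule makes the measurable dependence on the data explicit.\<close>

definition ridge_dual :: "nat \<Rightarrow> real \<Rightarrow> (nat \<Rightarrow> real^'d) \<Rightarrow> real^'d \<Rightarrow> real^'d" where
  "ridge_dual n s Z y =
     (\<chi> k. det (\<chi> i j. if j = k then y $ i else gram n s Z $ i $ j) / det (gram n s Z))"

lemma gram_mult_vector: "gram n s Z *v u = (\<Sum>i<n. (Z i \<bullet> u) *\<^sub>R Z i) + s *\<^sub>R u"
proof -
  have "(gram n s Z *v u) $ a = ((\<Sum>i<n. (Z i \<bullet> u) *\<^sub>R Z i) + s *\<^sub>R u) $ a" for a
  proof -
    have "(gram n s Z *v u) $ a = (\<Sum>b\<in>UNIV. (\<Sum>i<n. Z i $ a * Z i $ b * u $ b)) + (\<Sum>b\<in>UNIV. (if a = b then s else 0) * u $ b)"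
      by (simp add: gram_def matrix_vector_mult_def distrib_right sum.distrib sum_distrib_right)
    also have "(\<Sum>b\<in>UNIV. (if a = b then s else 0) * u $ b) = s * u $ a"
      by (simp add: if_distrib[of "\<lambda>x. x * _"] cong: if_cong)
    also have "(\<Sum>b\<in>UNIV. (\<Sum>i<n. Z i $ a * Z i $ b * u $ b)) = (\<Sum>i<n. (Z i \<bullet> u) * Z i $ a)"
      by (subst sum.swap) (simp add: inner_vec_def sum_distrib_left mult_ac)
    finally show ?thesis by simp
  qed
  then show ?thesis by (simp add: vec_eq_iff)
qed

lemma gram_kernel:
  assumes "s > 0" "gram n s Z *v v = 0"
  shows "v = 0"
proof -
  have "0 = v \<bullet> (gram n s Z *v v)"
    using assms(2) by simp
  also have "\<dots> = (\<Sum>i<n. (Z i \<bullet> v)\<^sup>2) + s * (v \<bullet> v)"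
    by (simp add: gram_mult_vector inner_add_right inner_sum_right inner_commute power2_eq_square)
  finally have "s * (v \<bullet> v) \<le> 0"
    by (smt (verit) sum_nonneg zero_le_power2)
  then show ?thesis
    using assms(1) by (metis inner_eq_zero_iff inner_ge_zero mult_le_0_iff not_le order_antisym)
qed

text \<open>For positive \<open>s\<close> the determinant in Cramer's rule is nonzero. Apart from
  measurability, \<open>ridge_dual\<close> is used only through this linear equation.\<close>

lemma gram_ridge_dual:
  assumes "s > 0"
  shows "gram n s Z *v ridge_dual n s Z y = y"
proof -
  have "invertible (gram n s Z)"
    using gram_kernel[OF assms, of n Z] matrix_left_invertible_ker[of "gram n s Z"] invertible_left_inverse by blast
  then have "det (gram n s Z) \<noteq> 0"
    by (simp add: invertible_det_nz)
  then show ?thesis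
    using cramer[of "gram n s Z" "ridge_dual n s Z y" y] by (simp add: ridge_dual_def)
qed

text \<open>The solution operator inherits symmetry from \<open>gram\<close>. It moves from the test
  point to the sample vectors, which exhibits each ridge weight as a linear functional of the test
  point.\<close>

lemma ridge_dual_symmetric:
  assumes "s > 0"
  shows "v \<bullet> ridge_dual n s Z w = ridge_dual n s Z v \<bullet> w"
proof -
  have sym: "transpose (gram n s Z) = gram n s Z"
    by (auto simp: gram_def transpose_def vec_eq_iff mult.commute intro!: sum.cong)
  have "v \<bullet> ridge_dual n s Z w = (gram n s Z *v ridge_dual n s Z v) \<bullet> ridge_dual n s Z w"
    by (simp add: gram_ridge_dual[OF assms])
  also have "\<dots> = ridge_dual n s Z v \<bullet> w"
    unfolding symmetric_matrix_inner[OF sym, symmetric] by (simp add: gram_ridge_dual[OF assms])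
  finally show ?thesis .
qed

text \<open>The normal equation rearranged: the part of the target missed by the ridge fit is
  \<open>s\<close> times the dual vector, so the bias of ridge regression is explicit.\<close>

lemma ridge_residual:
  assumes "s > 0"
  shows "y - (\<Sum>i<n. (Z i \<bullet> ridge_dual n s Z y) *\<^sub>R Z i) = s *\<^sub>R ridge_dual n s Z y"
  using gram_ridge_dual[OF assms, of n Z y] by (simp add: gram_mult_vector algebra_simps)

text \<open>Completing the square around the ridge weights: the cross terms from the residual and
  from the penalty are \<open>- 2 * s * (u \<bullet> D)\<close> and
  \<open>2 * s * (u \<bullet> D)\<close> and cancel, so the excess of any \<open>k\<close> is the
  squared norm of \<open>D\<close> plus the penalty of \<open>d\<close>.\<close>

lemma ridge_optimal:
  fixes y :: "real^'d" and n :: nat and Z :: "nat \<Rightarrow> real^'d"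
  assumes "s > 0"
  defines "u \<equiv> ridge_dual n s Z y"
  shows "(norm (s *\<^sub>R u))\<^sup>2 + s * (\<Sum>i<n. (Z i \<bullet> u)\<^sup>2) \<le>
         (norm (y - (\<Sum>i<n. k i *\<^sub>R Z i)))\<^sup>2 + s * (\<Sum>i<n. (k i)\<^sup>2)"
proof -
  define d where "d i = k i - Z i \<bullet> u" for i
  define D where "D = (\<Sum>i<n. d i *\<^sub>R Z i)"
  have "(\<Sum>i<n. k i *\<^sub>R Z i) = (\<Sum>i<n. (Z i \<bullet> u) *\<^sub>R Z i) + D"
    by (simp add: D_def d_def sum.distrib[symmetric] scaleR_diff_left)
  then have res: "y - (\<Sum>i<n. k i *\<^sub>R Z i) = s *\<^sub>R u - D"
    using ridge_residual[OF assms(1), of y Z n] by (simp add: u_def algebra_simps)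
  have uD: "u \<bullet> D = (\<Sum>i<n. d i * (Z i \<bullet> u))"
    by (simp add: D_def inner_sum_right inner_commute)
  have "(norm (s *\<^sub>R u - D))\<^sup>2 = (norm (s *\<^sub>R u))\<^sup>2 - 2 * s * (u \<bullet> D) + (norm D)\<^sup>2"
    unfolding power2_norm_eq_inner
    by (simp add: inner_diff_left inner_diff_right inner_commute[of D u] algebra_simps)
  moreover have "(\<Sum>i<n. (k i)\<^sup>2) = (\<Sum>i<n. (Z i \<bullet> u)\<^sup>2) + 2 * (u \<bullet> D) + (\<Sum>i<n. (d i)\<^sup>2)"
  proof -
    have "(k i)\<^sup>2 = (Z i \<bullet> u)\<^sup>2 + 2 * (d i * (Z i \<bullet> u)) + (d i)\<^sup>2" for i
      by (simp add: d_def power2_eq_square algebra_simps)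
    then show ?thesis
      by (simp add: uD sum.distrib sum_distrib_left)
  qed
  ultimately have "(norm (y - (\<Sum>i<n. k i *\<^sub>R Z i)))\<^sup>2 + s * (\<Sum>i<n. (k i)\<^sup>2) =
     (norm (s *\<^sub>R u))\<^sup>2 + s * (\<Sum>i<n. (Z i \<bullet> u)\<^sup>2) + (norm D)\<^sup>2 + s * (\<Sum>i<n. (d i)\<^sup>2)"
    by (simp add: res algebra_simps)
  moreover have "0 \<le> s * (\<Sum>i<n. (d i)\<^sup>2)"
    using assms(1) by (simp add: sum_nonneg)
  ultimately show ?thesis by simp
qed

text \<open>The ridge objective for the target \<open>y\<close> at the weights
  \<open>c * (Z i \<bullet> y)\<close>, the comparison rule whose expectation needs only second and
  fourth moments.\<close>

definition linear_cost :: "nat \<Rightarrow> real \<Rightarrow> real \<Rightarrow> real^'d \<Rightarrow> (nat \<Rightarrow> real^'d) \<Rightarrow> real" where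
  "linear_cost n s c y Z = (norm (y - (\<Sum>i<n. (c * (Z i \<bullet> y)) *\<^sub>R Z i)))\<^sup>2 + s * (\<Sum>i<n. (c * (Z i \<bullet> y))\<^sup>2)"

text \<open>Optimality bounds the correlation of the ridge weights with the vector of
  \<open>Z i \<bullet> y\<close> from below by one minus the comparison cost. The inequality l^2
  \<ge> 2 l g - g^2 with g = c (z_i . y) turns this correlation into a bound on the squared
  weights.\<close>

lemma ridge_weights_lower_bound:
  fixes y :: "real^'d"
  assumes s: "s > 0" and c: "c \<ge> 0" and y: "y \<bullet> y = 1"
  shows "2 * c * (1 - linear_cost n s c y Z) - c\<^sup>2 * (\<Sum>i<n. (Z i \<bullet> y)\<^sup>2)
    \<le> (\<Sum>i<n. (Z i \<bullet> ridge_dual n s Z y)\<^sup>2)"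
proof -
  define u where "u = ridge_dual n s Z y"
  have res: "(\<Sum>i<n. (Z i \<bullet> u) *\<^sub>R Z i) = y - s *\<^sub>R u"
    using ridge_residual[OF s, of y Z n] by (simp add: u_def algebra_simps)
  have "(\<Sum>i<n. (Z i \<bullet> u) * (Z i \<bullet> y)) = y \<bullet> (y - s *\<^sub>R u)"
    unfolding res[symmetric] by (simp add: inner_sum_right inner_commute mult.commute)
  then have cross: "(\<Sum>i<n. (Z i \<bullet> u) * (Z i \<bullet> y)) = 1 - s * (y \<bullet> u)"
    by (simp add: inner_diff_right y)
  \<comment> \<open>With the residual equal to \<open>s *\<^sub>R u\<close>, bias and penalty add up
    to \<open>s * (y \<bullet> u)\<close>, which is exactly the quantity missing from 1 in
    \<open>cross\<close>.\<close>
  have "(\<Sum>i<n. (Z i \<bullet> u)\<^sup>2) = u \<bullet> (y - s *\<^sub>R u)"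
    unfolding res[symmetric] by (simp add: inner_sum_right inner_commute power2_eq_square)
  then have "(norm (s *\<^sub>R u))\<^sup>2 + s * (\<Sum>i<n. (Z i \<bullet> u)\<^sup>2) = s * (y \<bullet> u)"
    unfolding power2_norm_eq_inner
    by (simp add: inner_diff_right inner_commute distrib_left[symmetric] flip: mult.assoc)
       (simp add: algebra_simps)
  then have "s * (y \<bullet> u) \<le> linear_cost n s c y Z"
    using ridge_optimal[OF s, where n = n and Z = Z and y = y and k = "\<lambda>i. c * (Z i \<bullet> y)"]
    by (simp add: u_def linear_cost_def)
  then have "2 * c * (1 - linear_cost n s c y Z) \<le> 2 * c * (\<Sum>i<n. (Z i \<bullet> u) * (Z i \<bullet> y))"
    unfolding cross using c by (intro mult_left_mono) auto
  moreover have "2 * c * (\<Sum>i<n. (Z i \<bullet> u) * (Z i \<bullet> y)) - c\<^sup>2 * (\<Sum>i<n. (Z i \<bullet> y)\<^sup>2) \<le> (\<Sum>i<n. (Z i \<bullet> u)\<^sup>2)"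
  proof -
    have "2 * c * ((Z i \<bullet> u) * (Z i \<bullet> y)) - c\<^sup>2 * (Z i \<bullet> y)\<^sup>2 \<le> (Z i \<bullet> u)\<^sup>2" for i
      using zero_le_power2[of "Z i \<bullet> u - c * (Z i \<bullet> y)"] by (simp add: power2_eq_square algebra_simps)
    then show ?thesis
      by (simp add: sum_distrib_left sum_subtractf[symmetric] sum_mono)
  qed
  ultimately show ?thesis
    unfolding u_def by linarith
qed

text \<open>The double sum is the squared length of the combination of the \<open>Z i\<close> with
  coefficients \<open>Z i \<bullet> y\<close>. In this form the diagonal yields fourth moments and
  the off-diagonal terms factor over independent samples.\<close>

lemma linear_cost_expand:
  assumes "y \<bullet> y = 1"
  shows "linear_cost n s c y Z = 1 + (s * c\<^sup>2 - 2 * c) * (\<Sum>i<n. (Z i \<bullet> y)\<^sup>2)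
     + c\<^sup>2 * (\<Sum>i<n. \<Sum>k<n. (Z i \<bullet> y) * (Z k \<bullet> y) * (Z i \<bullet> Z k))"
proof -
  let ?W = "\<Sum>i<n. (c * (Z i \<bullet> y)) *\<^sub>R Z i"
  have "y \<bullet> ?W = c * (\<Sum>i<n. (Z i \<bullet> y)\<^sup>2)"
    by (simp add: inner_sum_right sum_distrib_left power2_eq_square inner_commute mult_ac)
  moreover have "?W \<bullet> ?W = c\<^sup>2 * (\<Sum>i<n. \<Sum>k<n. (Z i \<bullet> y) * (Z k \<bullet> y) * (Z i \<bullet> Z k))"
    unfolding inner_sum_right inner_sum_left
    by (simp add: sum_distrib_left power2_eq_square mult_ac inner_commute)
  moreover have "(norm (y - ?W))\<^sup>2 = y \<bullet> y - 2 * (y \<bullet> ?W) + ?W \<bullet> ?W"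
    by (simp add: power2_norm_eq_inner inner_diff_left inner_diff_right inner_commute)
  ultimately show ?thesis
    using assms by (simp add: linear_cost_def power_mult_distrib sum_distrib_left[symmetric] algebra_simps)
qed

section \<open>Measurability of vector-valued maps and of the ridge solution\<close>

lemma borel_measurable_vec_component[measurable (raw)]:
  fixes f :: "'a \<Rightarrow> real^'d"
  shows "f \<in> borel_measurable N \<Longrightarrow> (\<lambda>w. f w $ i) \<in> borel_measurable N"
  using borel_measurable_inner[of f N "\<lambda>_. axis i 1"] by (simp add: inner_axis)

lemma borel_measurable_vec_lambda:
  fixes f :: "'d::finite \<Rightarrow> 'a \<Rightarrow> real"
  assumes "\<And>i. f i \<in> borel_measurable N"
  shows "(\<lambda>w. \<chi> i. f i w) \<in> borel_measurable N"
  unfolding borel_measurable_euclidean_space[where 'c = "real^'d"]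
  using assms by (auto simp: Basis_vec_def inner_axis)

lemma borel_measurable_matrix_vector_mult[measurable (raw)]:
  fixes T :: "real^'d^'d"
  assumes "f \<in> borel_measurable N"
  shows "(\<lambda>w. T *v f w) \<in> borel_measurable N"
  using assms unfolding matrix_vector_mult_def
  by (intro borel_measurable_vec_lambda) measurable

text \<open>By Cramer's rule each coordinate is a quotient of two determinants, and a determinant is
  a finite sum of products of measurable entries.\<close>

lemma borel_measurable_ridge_dual:
  fixes Z :: "nat \<Rightarrow> 'a \<Rightarrow> real^'d"
  assumes [measurable]: "\<And>i. i < n \<Longrightarrow> Z i \<in> borel_measurable N" "y \<in> borel_measurable N"
  shows "(\<lambda>w. ridge_dual n s (\<lambda>i. Z i w) (y w)) \<in> borel_measurable N"
proof -
  have det: "(\<lambda>w. det (\<chi> i j. F i j w)) \<in> borel_measurable N"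
    if [measurable]: "\<And>i j. F i j \<in> borel_measurable N" for F :: "'d \<Rightarrow> 'd \<Rightarrow> 'a \<Rightarrow> real"
    unfolding det_def by simp
  have g: "(\<lambda>w. (\<Sum>i<n. Z i w $ a * Z i w $ b) + (if a = b then s else 0)) \<in> borel_measurable N" for a b
    by (intro borel_measurable_add borel_measurable_sum borel_measurable_times borel_measurable_vec_component) auto
  show ?thesis
    unfolding ridge_dual_def
  proof (intro borel_measurable_vec_lambda borel_measurable_divide)
    show "(\<lambda>w. det (gram n s (\<lambda>i. Z i w))) \<in> borel_measurable N"
      unfolding gram_def by (rule det[OF g])
    show "(\<lambda>w. det (\<chi> i j. if j = k then y w $ i else gram n s (\<lambda>i. Z i w) $ i $ j)) \<in> borel_measurable N" for k
    proof (intro det)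
      show "(\<lambda>w. if j = k then y w $ i else gram n s (\<lambda>i. Z i w) $ i $ j) \<in> borel_measurable N" for i j
        unfolding gram_def using g[of i j] by (cases "j = k") simp_all
    qed
  qed
qed

section \<open>Second and fourth moments of the design\<close>

text \<open>Independence of two coordinates, read off from the product formula for the family
  \<open>F\<close> that is \<open>f\<close> at \<open>i\<close>, \<open>g\<close> at
  \<open>k\<close> and 1 elsewhere; the constant factors integrate to 1 because \<open>M\<close> is
  a probability measure.\<close>

lemma
  fixes f g :: "'a \<Rightarrow> real"
  assumes M: "prob_space M" and I: "finite I" "i \<in> I" "k \<in> I" "i \<noteq> k"
    and f: "integrable M f" and g: "integrable M g"
  shows integrable_PiM_mult_distinct: "integrable (PiM I (\<lambda>_. M)) (\<lambda>w. f (w i) * g (w k))"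
    and integral_PiM_mult_distinct: "(\<integral> w. f (w i) * g (w k) \<partial>PiM I (\<lambda>_. M)) = (\<integral> x. f x \<partial>M) * (\<integral> x. g x \<partial>M)"
proof -
  interpret M: prob_space M by (rule M)
  interpret PM: product_prob_space "\<lambda>_. M" by standard
  define F where "F r = (if r = i then f else if r = k then g else (\<lambda>_. 1))" for r
  \<comment> \<open>The abstract \<open>h\<close> lets one computation collapse both the product of
    function values and the product of integrals.\<close>
  have prod: "(\<Prod>r\<in>I. h (F r) r) = h f i * h g k" if "\<And>r. h (\<lambda>_. 1) r = 1" for h :: "('a \<Rightarrow> real) \<Rightarrow> 'b \<Rightarrow> real"
  proof -
    have "(\<Prod>r\<in>I. h (F r) r) = (\<Prod>r\<in>{i, k}. h (F r) r)"
      using I that by (intro prod.mono_neutral_right) (auto simp: F_def)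
    then show ?thesis
      using I by (simp add: F_def)
  qed
  have int: "integrable M (F r)" for r
    using f g by (simp add: F_def)
  show "integrable (PiM I (\<lambda>_. M)) (\<lambda>w. f (w i) * g (w k))"
    using PM.product_integrable_prod[OF I(1), of F] int prod[of "\<lambda>p r. p (w r)" for w] by simp
  show "(\<integral> w. f (w i) * g (w k) \<partial>PiM I (\<lambda>_. M)) = (\<integral> x. f x \<partial>M) * (\<integral> x. g x \<partial>M)"
    using PM.product_integral_prod[OF I(1), of F] int prod[of "\<lambda>p r. p (w r)" for w]
      prod[of "\<lambda>p r. \<integral> x. p x \<partial>M"] by (simp add: M.prob_space)
qed

lemma
  fixes f :: "'a \<Rightarrow> real"
  assumes M: "prob_space M" and I: "i \<in> I"
    and f: "integrable M f"
  shows integrable_PiM_component: "integrable (PiM I (\<lambda>_. M)) (\<lambda>w. f (w i))"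
    and integral_PiM_component: "(\<integral> w. f (w i) \<partial>PiM I (\<lambda>_. M)) = (\<integral> x. f x \<partial>M)"
proof -
  have d: "distr (PiM I (\<lambda>_. M)) M (\<lambda>w. w i) = M"
    by (rule distr_PiM_component) (use assms in auto)
  have m: "(\<lambda>w. w i) \<in> measurable (PiM I (\<lambda>_. M)) M"
    using I by simp
  show "integrable (PiM I (\<lambda>_. M)) (\<lambda>w. f (w i))"
    using integrable_distr[OF m, of f] f d by simp
  show "(\<integral> w. f (w i) \<partial>PiM I (\<lambda>_. M)) = (\<integral> x. f x \<partial>M)"
    using integral_distr[OF m, of f] f d by simp
qed

text \<open>\<open>S\<close> is the uncentred second-moment matrix. The locale is instantiated for
  the parameter under the prior, for the covariate, and for the covariate transformed by the square
  root of \<open>H\<close>.\<close>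

locale random_vector = prob_space M for M :: "'a measure" +
  fixes Z :: "'a \<Rightarrow> real^'d" and S :: "real^'d^'d"
  assumes measurable_Z[measurable]: "Z \<in> borel_measurable M"
    and Z_sq: "integrable M (\<lambda>x. (norm (Z x))\<^sup>2)"
    and S_def: "S = (\<chi> a b. \<integral> x. Z x $ a * Z x $ b \<partial>M)"
begin

lemma integrable_inner_mult: "integrable M (\<lambda>x. (v \<bullet> Z x) * (w \<bullet> Z x))"
proof (rule Bochner_Integration.integrable_bound[of M "\<lambda>x. norm v * norm w * (norm (Z x))\<^sup>2"])
  show "integrable M (\<lambda>x. norm v * norm w * (norm (Z x))\<^sup>2)"
    using Z_sq by simp
  show "AE x in M. norm ((v \<bullet> Z x) * (w \<bullet> Z x)) \<le> norm (norm v * norm w * (norm (Z x))\<^sup>2)"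
  proof (rule AE_I2)
    fix x
    have "\<bar>v \<bullet> Z x\<bar> * \<bar>w \<bullet> Z x\<bar> \<le> (norm v * norm (Z x)) * (norm w * norm (Z x))"
      by (intro mult_mono Cauchy_Schwarz_ineq2) auto
    then show "norm ((v \<bullet> Z x) * (w \<bullet> Z x)) \<le> norm (norm v * norm w * (norm (Z x))\<^sup>2)"
      by (simp add: abs_mult power2_eq_square mult_ac)
  qed
qed measurable

lemma integrable_coord_mult: "integrable M (\<lambda>x. Z x $ a * Z x $ b)"
  using integrable_inner_mult[of "axis a 1" "axis b 1"] by (simp add: inner_axis')

lemma integral_inner_mult: "(\<integral> x. (v \<bullet> Z x) * (w \<bullet> Z x) \<partial>M) = v \<bullet> (S *v w)"
proof -
  have eq: "(v \<bullet> Z x) * (w \<bullet> Z x) = (\<Sum>a\<in>UNIV. \<Sum>b\<in>UNIV. v $ a * w $ b * (Z x $ a * Z x $ b))" for x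
    by (simp add: inner_vec_def sum_product mult_ac)
  have "(\<integral> x. (v \<bullet> Z x) * (w \<bullet> Z x) \<partial>M) = (\<Sum>a\<in>UNIV. \<Sum>b\<in>UNIV. v $ a * w $ b * (\<integral> x. Z x $ a * Z x $ b \<partial>M))"
    unfolding eq using integrable_coord_mult by simp
  also have "\<dots> = v \<bullet> (S *v w)"
    by (simp add: S_def inner_vec_def matrix_vector_mult_def sum_distrib_left mult_ac)
  finally show ?thesis .
qed

lemma psd_S: "psd_mat S"
proof -
  have "transpose S = S"
    by (simp add: S_def transpose_def vec_eq_iff mult.commute)
  moreover have "0 \<le> v \<bullet> (S *v v)" for v
    unfolding integral_inner_mult[symmetric] by (rule integral_nonneg_AE) auto
  ultimately show ?thesis by (simp add: psd_mat_def)
qed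

text \<open>The expected cost is at most a quadratic in \<open>c\<close> whose minimiser is 1/(s + K
  + n d). Since n \<lambda> = s + K, this is the given \<open>c\<close>, and the minimum is 1 - d/(d
  + \<lambda>).\<close>

lemma expected_linear_cost:
  assumes y: "y \<bullet> y = 1" "S *v y = d *\<^sub>R y"
    and fourth: "integrable M (\<lambda>x. (norm (Z x))\<^sup>2 * (y \<bullet> Z x)\<^sup>2)"
    and K: "(\<integral> x. (norm (Z x))\<^sup>2 * (y \<bullet> Z x)\<^sup>2 \<partial>M) \<le> K * d"
    and s: "s \<ge> 0" and n: "n \<ge> 1"
    and lam: "lam = (s + K) / real n" "d + lam > 0"
    and c: "c = 1 / (d + lam) / real n"
  shows "integrable (PiM {..<n} (\<lambda>_. M)) (\<lambda>w. \<Sum>i<n. (Z (w i) \<bullet> y)\<^sup>2)" (is ?i1)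
    and "(\<integral> w. (\<Sum>i<n. (Z (w i) \<bullet> y)\<^sup>2) \<partial>PiM {..<n} (\<lambda>_. M)) = real n * d" (is ?e1)
    and "integrable (PiM {..<n} (\<lambda>_. M)) (\<lambda>w. linear_cost n s c y (\<lambda>i. Z (w i)))" (is ?i2)
    and "(\<integral> w. linear_cost n s c y (\<lambda>i. Z (w i)) \<partial>PiM {..<n} (\<lambda>_. M)) \<le> 1 - d / (d + lam)" (is ?e2)
proof -
  let ?P = "PiM {..<n} (\<lambda>_. M)"
  have yy: "integrable M (\<lambda>x. (Z x \<bullet> y)\<^sup>2)" "(\<integral> x. (Z x \<bullet> y)\<^sup>2 \<partial>M) = d"
    using integrable_inner_mult[of y y] integral_inner_mult[of y y] y
    by (simp_all add: power2_eq_square inner_commute)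
  have i1: "integrable ?P (\<lambda>w. (Z (w i) \<bullet> y)\<^sup>2)" "(\<integral> w. (Z (w i) \<bullet> y)\<^sup>2 \<partial>?P) = d" if "i < n" for i
    using integrable_PiM_component[OF prob_space_axioms _ yy(1), of i "{..<n}"]
      integral_PiM_component[OF prob_space_axioms _ yy(1), of i "{..<n}"] yy(2) that by auto
  show ?i1 using i1 by (intro Bochner_Integration.integrable_sum) auto
  show ?e1 using i1 by (subst Bochner_Integration.integral_sum) auto
  have diag: "integrable ?P (\<lambda>w. (Z (w i) \<bullet> y) * (Z (w i) \<bullet> y) * (Z (w i) \<bullet> Z (w i)))"
    "(\<integral> w. (Z (w i) \<bullet> y) * (Z (w i) \<bullet> y) * (Z (w i) \<bullet> Z (w i)) \<partial>?P) \<le> K * d" if "i < n" for i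
  proof -
    have eq: "(Z x \<bullet> y) * (Z x \<bullet> y) * (Z x \<bullet> Z x) = (norm (Z x))\<^sup>2 * (y \<bullet> Z x)\<^sup>2" for x
      unfolding power2_norm_eq_inner by (simp add: power2_eq_square inner_commute mult_ac)
    show "integrable ?P (\<lambda>w. (Z (w i) \<bullet> y) * (Z (w i) \<bullet> y) * (Z (w i) \<bullet> Z (w i)))"
      unfolding eq using integrable_PiM_component[OF prob_space_axioms _ fourth, of i "{..<n}"] that by auto
    show "(\<integral> w. (Z (w i) \<bullet> y) * (Z (w i) \<bullet> y) * (Z (w i) \<bullet> Z (w i)) \<partial>?P) \<le> K * d"
      unfolding eq using integral_PiM_component[OF prob_space_axioms _ fourth, of i "{..<n}"] that K by auto
  qed
  \<comment> \<open>For distinct samples the inner product is split into coordinates. By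
    independence each term is the square of E[(y . Z) Z_a] = (S y)_a = d y_a, and these squares sum
    to d^2 because \<open>y\<close> is a unit vector.\<close>
  have off: "integrable ?P (\<lambda>w. (Z (w i) \<bullet> y) * (Z (w k) \<bullet> y) * (Z (w i) \<bullet> Z (w k)))"
    "(\<integral> w. (Z (w i) \<bullet> y) * (Z (w k) \<bullet> y) * (Z (w i) \<bullet> Z (w k)) \<partial>?P) = d\<^sup>2"
    if "i < n" "k < n" "i \<noteq> k" for i k
  proof -
    have ca: "integrable M (\<lambda>x. (y \<bullet> Z x) * Z x $ a)" "(\<integral> x. (y \<bullet> Z x) * Z x $ a \<partial>M) = d * y $ a" for a
    proof -
      show "integrable M (\<lambda>x. (y \<bullet> Z x) * Z x $ a)"
        using integrable_inner_mult[of y "axis a 1"] by (simp add: inner_axis')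
      show "(\<integral> x. (y \<bullet> Z x) * Z x $ a \<partial>M) = d * y $ a"
        using integral_inner_mult[of "axis a 1" y] by (simp add: inner_axis' y mult.commute)
    qed
    have eq: "(Z x \<bullet> y) * (Z x' \<bullet> y) * (Z x \<bullet> Z x') = (\<Sum>a\<in>UNIV. ((y \<bullet> Z x) * Z x $ a) * ((y \<bullet> Z x') * Z x' $ a))" for x x'
      unfolding inner_vec_def[of "Z x" "Z x'"] sum_distrib_left
      by (simp add: inner_commute[of "Z x" y] inner_commute[of "Z x'" y] mult_ac)
    have int: "integrable ?P (\<lambda>w. ((y \<bullet> Z (w i)) * Z (w i) $ a) * ((y \<bullet> Z (w k)) * Z (w k) $ a))"
      and val: "(\<integral> w. ((y \<bullet> Z (w i)) * Z (w i) $ a) * ((y \<bullet> Z (w k)) * Z (w k) $ a) \<partial>?P) = (d * y $ a) * (d * y $ a)" for a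
      using integrable_PiM_mult_distinct[OF prob_space_axioms _ _ _ that(3) ca(1)[of a] ca(1)[of a], of "{..<n}"]
        integral_PiM_mult_distinct[OF prob_space_axioms _ _ _ that(3) ca(1)[of a] ca(1)[of a], of "{..<n}"] that
      by (simp_all add: ca(2))
    show "integrable ?P (\<lambda>w. (Z (w i) \<bullet> y) * (Z (w k) \<bullet> y) * (Z (w i) \<bullet> Z (w k)))"
      unfolding eq using int by simp
    have "(\<integral> w. (Z (w i) \<bullet> y) * (Z (w k) \<bullet> y) * (Z (w i) \<bullet> Z (w k)) \<partial>?P) = (\<Sum>a\<in>UNIV. (d * y $ a) * (d * y $ a))"
      unfolding eq using int by (simp add: val)
    also have "\<dots> = d\<^sup>2 * (y \<bullet> y)"
      by (simp add: inner_vec_def sum_distrib_left power2_eq_square mult_ac)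
    finally show "(\<integral> w. (Z (w i) \<bullet> y) * (Z (w k) \<bullet> y) * (Z (w i) \<bullet> Z (w k)) \<partial>?P) = d\<^sup>2"
      using y by simp
  qed
  have int2: "integrable ?P (\<lambda>w. (Z (w i) \<bullet> y) * (Z (w k) \<bullet> y) * (Z (w i) \<bullet> Z (w k)))" if "i < n" "k < n" for i k
    using diag(1)[of i] off(1)[of i k] that by (cases "i = k") auto
  have dsum: "(\<Sum>i<n. \<Sum>k<n. (\<integral> w. (Z (w i) \<bullet> y) * (Z (w k) \<bullet> y) * (Z (w i) \<bullet> Z (w k)) \<partial>?P))
      \<le> (real n)\<^sup>2 * d\<^sup>2 + real n * (K * d)"
  proof -
    \<comment> \<open>The diagonal bound is relaxed by an extra \<open>d\<^sup>2\<close>. This gives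
      the full count n^2 of terms \<open>d\<^sup>2\<close>, so that the total matches the choice of
      \<open>lam\<close> exactly.\<close>
    have "(\<integral> w. (Z (w i) \<bullet> y) * (Z (w k) \<bullet> y) * (Z (w i) \<bullet> Z (w k)) \<partial>?P) \<le> d\<^sup>2 + (if i = k then K * d else 0)"
      if "i < n" "k < n" for i k
      using diag(2)[of i] off(2)[of i k] that by (cases "i = k") (auto simp: add_increasing)
    then have "(\<Sum>i<n. \<Sum>k<n. (\<integral> w. (Z (w i) \<bullet> y) * (Z (w k) \<bullet> y) * (Z (w i) \<bullet> Z (w k)) \<partial>?P))
      \<le> (\<Sum>i<n. \<Sum>k<n. d\<^sup>2 + (if i = k then K * d else 0))"
      by (intro sum_mono) auto
    also have "\<dots> = (real n)\<^sup>2 * d\<^sup>2 + real n * (K * d)"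
      by (simp add: sum.distrib power2_eq_square algebra_simps)
    finally show ?thesis .
  qed
  have S1: "integrable ?P (\<lambda>w. \<Sum>i<n. (Z (w i) \<bullet> y)\<^sup>2)" "(\<integral> w. (\<Sum>i<n. (Z (w i) \<bullet> y)\<^sup>2) \<partial>?P) = real n * d"
    by fact+
  have S2: "integrable ?P (\<lambda>w. \<Sum>i<n. \<Sum>k<n. (Z (w i) \<bullet> y) * (Z (w k) \<bullet> y) * (Z (w i) \<bullet> Z (w k)))"
    "(\<integral> w. (\<Sum>i<n. \<Sum>k<n. (Z (w i) \<bullet> y) * (Z (w k) \<bullet> y) * (Z (w i) \<bullet> Z (w k))) \<partial>?P) =
     (\<Sum>i<n. \<Sum>k<n. (\<integral> w. (Z (w i) \<bullet> y) * (Z (w k) \<bullet> y) * (Z (w i) \<bullet> Z (w k)) \<partial>?P))"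
  proof -
    have inner: "integrable ?P (\<lambda>w. \<Sum>k<n. (Z (w i) \<bullet> y) * (Z (w k) \<bullet> y) * (Z (w i) \<bullet> Z (w k)))"
      "(\<integral> w. (\<Sum>k<n. (Z (w i) \<bullet> y) * (Z (w k) \<bullet> y) * (Z (w i) \<bullet> Z (w k))) \<partial>?P) =
       (\<Sum>k<n. (\<integral> w. (Z (w i) \<bullet> y) * (Z (w k) \<bullet> y) * (Z (w i) \<bullet> Z (w k)) \<partial>?P))" if "i < n" for i
    proof -
      show "integrable ?P (\<lambda>w. \<Sum>k<n. (Z (w i) \<bullet> y) * (Z (w k) \<bullet> y) * (Z (w i) \<bullet> Z (w k)))"
        by (rule Bochner_Integration.integrable_sum) (use int2 that in auto)
      show "(\<integral> w. (\<Sum>k<n. (Z (w i) \<bullet> y) * (Z (w k) \<bullet> y) * (Z (w i) \<bullet> Z (w k))) \<partial>?P) =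
         (\<Sum>k<n. (\<integral> w. (Z (w i) \<bullet> y) * (Z (w k) \<bullet> y) * (Z (w i) \<bullet> Z (w k)) \<partial>?P))"
        by (rule Bochner_Integration.integral_sum) (use int2 that in auto)
    qed
    show "integrable ?P (\<lambda>w. \<Sum>i<n. \<Sum>k<n. (Z (w i) \<bullet> y) * (Z (w k) \<bullet> y) * (Z (w i) \<bullet> Z (w k)))"
      by (rule Bochner_Integration.integrable_sum) (use inner in auto)
    show "(\<integral> w. (\<Sum>i<n. \<Sum>k<n. (Z (w i) \<bullet> y) * (Z (w k) \<bullet> y) * (Z (w i) \<bullet> Z (w k))) \<partial>?P) =
     (\<Sum>i<n. \<Sum>k<n. (\<integral> w. (Z (w i) \<bullet> y) * (Z (w k) \<bullet> y) * (Z (w i) \<bullet> Z (w k)) \<partial>?P))"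
      by (subst Bochner_Integration.integral_sum) (use inner in auto)
  qed
  interpret PI: prob_space ?P by (rule prob_space_PiM) (rule prob_space_axioms)
  have lin: "integrable ?P (\<lambda>w. 1 + a * f w + b * g w)"
    "(\<integral> w. 1 + a * f w + b * g w \<partial>?P) = 1 + a * (\<integral> w. f w \<partial>?P) + b * (\<integral> w. g w \<partial>?P)"
    if "integrable ?P f" "integrable ?P g" for a b :: real and f g
    using that by (auto simp: PI.prob_space)
  show ?i2
    unfolding linear_cost_expand[OF y(1)] by (rule lin(1)[OF S1(1) S2(1)])
  have "(\<integral> w. linear_cost n s c y (\<lambda>i. Z (w i)) \<partial>?P) = 1 + (s * c\<^sup>2 - 2 * c) * (real n * d)
     + c\<^sup>2 * (\<Sum>i<n. \<Sum>k<n. (\<integral> w. (Z (w i) \<bullet> y) * (Z (w k) \<bullet> y) * (Z (w i) \<bullet> Z (w k)) \<partial>?P))"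
    unfolding linear_cost_expand[OF y(1)] lin(2)[OF S1(1) S2(1)] S1(2) S2(2) ..
  also have "\<dots> \<le> 1 + (s * c\<^sup>2 - 2 * c) * (real n * d) + c\<^sup>2 * ((real n)\<^sup>2 * d\<^sup>2 + real n * (K * d))"
    using dsum by (intro add_left_mono mult_left_mono) auto
  also have "\<dots> = 1 - d / (d + lam)"
  proof -
    define b where "b = 1 / (d + lam)"
    have b: "b * (d + lam) = 1" using lam(2) by (simp add: b_def)
    have cb: "c * real n = b" and nl: "real n * lam = s + K"
      using n lam(1) by (simp_all add: c b_def)
    have "(s * c\<^sup>2 - 2 * c) * (real n * d) + c\<^sup>2 * ((real n)\<^sup>2 * d\<^sup>2 + real n * (K * d))
       = c\<^sup>2 * real n * d * (s + K) - 2 * (c * real n) * d + (c * real n)\<^sup>2 * d\<^sup>2"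
      by (simp add: power2_eq_square algebra_simps)
    also have "\<dots> = (c * real n)\<^sup>2 * d * lam - 2 * (c * real n) * d + (c * real n)\<^sup>2 * d\<^sup>2"
      by (simp add: nl[symmetric] power2_eq_square)
    also have "\<dots> = b * d * (b * (d + lam)) - 2 * b * d"
      by (simp add: cb power2_eq_square algebra_simps)
    also have "\<dots> = - (b * d)"
      by (simp add: b)
    finally show ?thesis
      by (simp add: b_def)
  qed
  finally show ?e2 .
qed

text \<open>The pointwise lower bound is averaged for each eigenvector with its own constant
  \<open>c j\<close> = 1/(n (d_j + \<lambda>)). The resulting terms d_j (2 c_j d_j/(d_j + \<lambda>)
  - n c_j^2 d_j) equal d_j^2/(n (d_j + \<lambda>)^2) and sum to df2/n.\<close>

lemma expected_ridge_weights:
  fixes e :: "'d \<Rightarrow> real^'d"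
  assumes e: "eigenbasis S e d"
    and fourth: "\<And>j. integrable M (\<lambda>x. (norm (Z x))\<^sup>2 * (e j \<bullet> Z x)\<^sup>2)"
    and K: "\<And>j. (\<integral> x. (norm (Z x))\<^sup>2 * (e j \<bullet> Z x)\<^sup>2 \<partial>M) \<le> K * d j" "K \<ge> 0"
    and s: "s > 0" and n: "n \<ge> 1"
  shows "ennreal (df2 S ((s + K) / real n) / real n) \<le>
    (\<integral>\<^sup>+ w. ennreal (\<Sum>j\<in>UNIV. d j * (\<Sum>i<n. (Z (w i) \<bullet> ridge_dual n s (\<lambda>i. Z (w i)) (e j))\<^sup>2)) \<partial>PiM {..<n} (\<lambda>_. M))"
proof -
  let ?P = "PiM {..<n} (\<lambda>_. M)"
  define lam where "lam = (s + K) / real n"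
  have d: "0 \<le> d j" for j
    by (rule eigenbasis_psd_nonneg[OF e psd_S])
  have lam: "lam > 0"
    using s K(2) n by (simp add: lam_def)
  have dl: "d j + lam > 0" for j
    using d[of j] lam by linarith
  have ej: "e j \<bullet> e j = 1" "S *v e j = d j *\<^sub>R e j" for j
    using e by (auto simp: eigenbasis_def)
  define c where "c j = 1 / (d j + lam) / real n" for j
  have c: "c j \<ge> 0" for j
    using dl[of j] by (simp add: c_def)
  note cost = expected_linear_cost[OF ej fourth K(1) less_imp_le[OF s] n lam_def dl c_def]
  define g where "g w = (\<Sum>j\<in>UNIV. d j * (2 * c j * (1 - linear_cost n s (c j) (e j) (\<lambda>i. Z (w i)))
      - (c j)\<^sup>2 * (\<Sum>i<n. (Z (w i) \<bullet> e j)\<^sup>2)))" for w :: "nat \<Rightarrow> 'a"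
  interpret PI: prob_space ?P by (rule prob_space_PiM) (rule prob_space_axioms)
  have g_int: "integrable ?P g"
    unfolding g_def using cost(1,3) by simp
  have "df2 S lam / real n = (\<Sum>j\<in>UNIV. d j * (2 * c j * (d j / (d j + lam)) - (c j)\<^sup>2 * (real n * d j)))"
    unfolding df2_eigenbasis[OF e d lam] sum_divide_distrib
  proof (rule sum.cong[OF refl])
    fix j
    show "(d j)\<^sup>2 / (d j + lam)\<^sup>2 / real n = d j * (2 * c j * (d j / (d j + lam)) - (c j)\<^sup>2 * (real n * d j))"
      using n dl[of j] by (simp add: c_def power2_eq_square divide_simps)
  qed
  also have "\<dots> \<le> (\<Sum>j\<in>UNIV. d j * (2 * c j * (1 - (\<integral> w. linear_cost n s (c j) (e j) (\<lambda>i. Z (w i)) \<partial>?P)) - (c j)\<^sup>2 * (real n * d j)))"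
  proof (intro sum_mono mult_left_mono diff_right_mono)
    fix j
    show "d j / (d j + lam) \<le> 1 - (\<integral> w. linear_cost n s (c j) (e j) (\<lambda>i. Z (w i)) \<partial>?P)"
      using cost(4)[of j] by linarith
  qed (use c d in auto)
  also have "\<dots> = (\<integral> w. g w \<partial>?P)"
    unfolding g_def using cost(1,3) by (simp add: cost(2) PI.prob_space)
  finally have "df2 S lam / real n \<le> (\<integral> w. g w \<partial>?P)" .
  \<comment> \<open>The lower bound \<open>g\<close> may be negative at some samples, so it is
    truncated at 0 before passing to the nonnegative integral; the squared weights dominate the
    truncation as well.\<close>
  also have "\<dots> \<le> (\<integral> w. max 0 (g w) \<partial>?P)"
    using g_int by (intro integral_mono) auto
  finally have "ennreal (df2 S lam / real n) \<le> ennreal (\<integral> w. max 0 (g w) \<partial>?P)"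
    by (rule ennreal_leI)
  also have "\<dots> = (\<integral>\<^sup>+ w. ennreal (max 0 (g w)) \<partial>?P)"
    using g_int by (intro nn_integral_eq_integral[symmetric]) auto
  also have "\<dots> \<le> (\<integral>\<^sup>+ w. ennreal (\<Sum>j\<in>UNIV. d j * (\<Sum>i<n. (Z (w i) \<bullet> ridge_dual n s (\<lambda>i. Z (w i)) (e j))\<^sup>2)) \<partial>?P)"
  proof (intro nn_integral_mono ennreal_leI max.boundedI)
    fix w
    show "0 \<le> (\<Sum>j\<in>UNIV. d j * (\<Sum>i<n. (Z (w i) \<bullet> ridge_dual n s (\<lambda>i. Z (w i)) (e j))\<^sup>2))"
      using d by (intro sum_nonneg mult_nonneg_nonneg) auto
    show "g w \<le> (\<Sum>j\<in>UNIV. d j * (\<Sum>i<n. (Z (w i) \<bullet> ridge_dual n s (\<lambda>i. Z (w i)) (e j))\<^sup>2))"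
      unfolding g_def using d ridge_weights_lower_bound[OF s c ej(1)] by (intro sum_mono mult_left_mono) auto
  qed
  finally show ?thesis by (simp add: lam_def)
qed

lemma nn_integral_inner_square: "(\<integral>\<^sup>+ x. ennreal ((v \<bullet> Z x)\<^sup>2) \<partial>M) = ennreal (v \<bullet> (S *v v))"
  using integrable_inner_mult[of v v] unfolding integral_inner_mult[symmetric]
  by (simp add: nn_integral_eq_integral power2_eq_square)

text \<open>By symmetry of the solution operator the weight of sample i is
  \<open>v i \<bullet> Z x\<close> with \<open>v i\<close> free of the test point. Its second moment
  is the quadratic form of \<open>S\<close> at \<open>v i\<close>, which the eigenbasis
  diagonalises; the random test point is thus replaced by the fixed targets
  \<open>e j\<close>.\<close>

lemma nn_integral_ridge_weights:
  assumes e: "eigenbasis S e d" and s: "s > 0"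
  shows "(\<integral>\<^sup>+ x. ennreal (\<Sum>i<n. (z i \<bullet> ridge_dual n s z (Z x))\<^sup>2) \<partial>M) =
    ennreal (\<Sum>j\<in>UNIV. d j * (\<Sum>i<n. (z i \<bullet> ridge_dual n s z (e j))\<^sup>2))"
proof -
  define v where "v i = ridge_dual n s z (z i)" for i
  have v: "z i \<bullet> ridge_dual n s z y = v i \<bullet> y" for i y
    unfolding v_def by (rule ridge_dual_symmetric[OF s])
  have "(\<integral>\<^sup>+ x. ennreal (\<Sum>i<n. (z i \<bullet> ridge_dual n s z (Z x))\<^sup>2) \<partial>M) = (\<Sum>i<n. \<integral>\<^sup>+ x. ennreal ((v i \<bullet> Z x)\<^sup>2) \<partial>M)"
    unfolding v by (subst nn_integral_sum[symmetric]) (auto simp: sum_ennreal)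
  also have "\<dots> = ennreal (\<Sum>i<n. v i \<bullet> (S *v v i))"
    unfolding nn_integral_inner_square using psd_S by (intro sum_ennreal) (auto simp: psd_mat_def)
  also have "(\<Sum>i<n. v i \<bullet> (S *v v i)) = (\<Sum>j\<in>UNIV. d j * (\<Sum>i<n. (v i \<bullet> e j)\<^sup>2))"
    unfolding eigenbasis_quadratic_form[OF e] by (subst sum.swap) (simp add: sum_distrib_left)
  finally show ?thesis
    by (simp add: v)
qed

end

text \<open>Symmetry of \<open>T\<close> writes the coordinates of the image as inner products with
  the fixed vectors \<open>T *v axis a 1\<close>, so the moments follow from those of
  \<open>Z\<close>.\<close>

lemma random_vector_matrix_image:
  fixes T S :: "real^'d^'d"
  assumes "random_vector M Z S" and T: "transpose T = T"
  shows "random_vector M (\<lambda>x. T *v Z x) (T ** S ** T)"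
proof -
  interpret random_vector M Z S by (rule assms)
  have inner_T: "(T *v v) \<bullet> w = v \<bullet> (T *v w)" for v w
    by (rule symmetric_matrix_inner[OF T, symmetric])
  have comp: "(T *v v) $ a = (T *v axis a 1) \<bullet> v" for v a
    by (simp add: inner_T inner_axis')
  show ?thesis
  proof
    show "(\<lambda>x. T *v Z x) \<in> borel_measurable M" by measurable
    have "(norm (T *v Z x))\<^sup>2 = (\<Sum>a\<in>UNIV. ((T *v axis a 1) \<bullet> Z x) * ((T *v axis a 1) \<bullet> Z x))" for x
      unfolding power2_norm_eq_inner inner_vec_def[of "T *v Z x"] comp by simp
    then show "integrable M (\<lambda>x. (norm (T *v Z x))\<^sup>2)"
      using integrable_inner_mult by simp
    have "(T ** S ** T) $ a $ b = (\<integral> x. (T *v Z x) $ a * (T *v Z x) $ b \<partial>M)" for a b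
    proof -
      have "(\<integral> x. (T *v Z x) $ a * (T *v Z x) $ b \<partial>M) = (T *v axis a 1) \<bullet> (S *v (T *v axis b 1))"
        unfolding comp by (rule integral_inner_mult)
      also have "\<dots> = ((T ** S ** T) *v axis b 1) $ a"
        by (simp add: inner_T inner_axis' matrix_vector_mul_assoc matrix_mul_assoc)
      finally show ?thesis
        by (simp add: matrix_vector_mult_basis column_def)
    qed
    then show "T ** S ** T = (\<chi> a b. \<integral> x. (T *v Z x) $ a * (T *v Z x) $ b \<partial>M)"
      by (simp add: vec_eq_iff)
  qed
qed

section \<open>Averaging over the noise\<close>

text \<open>Two densities with equal integrals over all events \<open>p z \<in> B\<close> have the
  same image measure under \<open>p\<close>, hence agree against every nonnegative weight in
  \<open>p z\<close>. With \<open>p = fst\<close> this does the work of conditioning on the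
  covariate.\<close>

lemma nn_integral_weighted_eq:
  assumes [measurable]: "p \<in> measurable P N" "f \<in> borel_measurable P" "h \<in> borel_measurable P"
    and eq: "\<And>B. B \<in> sets N \<Longrightarrow>
      (\<integral>\<^sup>+ z. indicator B (p z) * f z \<partial>P) = (\<integral>\<^sup>+ z. indicator B (p z) * h z \<partial>P)"
    and [measurable]: "g \<in> borel_measurable N"
  shows "(\<integral>\<^sup>+ z. g (p z) * f z \<partial>P) = (\<integral>\<^sup>+ z. g (p z) * (h z :: ennreal) \<partial>P)"
proof -
  have "distr (density P f) N p = distr (density P h) N p"
  proof (rule measure_eqI)
    fix B assume "B \<in> sets (distr (density P f) N p)"
    then have B[measurable]: "B \<in> sets N" by simp
    have "emeasure (distr (density P k) N p) B = (\<integral>\<^sup>+ z. indicator B (p z) * k z \<partial>P)"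
      if [measurable]: "k \<in> borel_measurable P" for k
    proof -
      have "emeasure (distr (density P k) N p) B = (\<integral>\<^sup>+ z. k z * indicator (p -` B \<inter> space P) z \<partial>P)"
        by (subst emeasure_distr) (auto simp: emeasure_density)
      also have "\<dots> = (\<integral>\<^sup>+ z. indicator B (p z) * k z \<partial>P)"
        by (intro nn_integral_cong) (auto simp: indicator_def)
      finally show ?thesis .
    qed
    then show "emeasure (distr (density P f) N p) B = emeasure (distr (density P h) N p) B"
      using eq[OF B] by simp
  qed simp
  moreover have "(\<integral>\<^sup>+ z. g (p z) * k z \<partial>P) = (\<integral>\<^sup>+ y. g y \<partial>distr (density P k) N p)"
    if [measurable]: "k \<in> borel_measurable P" for k
    by (subst nn_integral_distr) (auto simp: nn_integral_density mult.commute)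
  ultimately show ?thesis by simp
qed

locale noise_model =
  fixes P :: "((real^'d) \<times> real) measure" and s :: real
  assumes prob: "prob_space P" and sets_P: "sets P = sets borel"
    and eps_sq: "integrable P (\<lambda>z. (snd z)\<^sup>2)"
    and eps_mean: "\<And>B. B \<in> sets borel \<Longrightarrow> (\<integral> z. indicator B (fst z) * snd z \<partial>P) = 0"
    and eps_var: "\<And>B. B \<in> sets borel \<Longrightarrow>
        (\<integral> z. indicator B (fst z) * (snd z)\<^sup>2 \<partial>P) = s * (\<integral> z. indicator B (fst z) \<partial>P)"
    and s_nonneg: "0 \<le> s"
begin

sublocale prob_space P by (rule prob)

lemma measurable_fst_snd[measurable]:
  "fst \<in> borel_measurable P" "snd \<in> borel_measurable P"
  unfolding measurable_cong_sets[OF sets_P refl] borel_prod[symmetric] by auto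

lemma eps_integrable: "integrable P snd"
  using eps_sq square_integrable_imp_integrable[of snd] by auto

definition design :: "(real^'d) measure" where
  "design = distr P borel fst"

lemma sets_design[measurable_cong, simp]: "sets design = sets borel"
  by (simp add: design_def)

lemma nn_integral_design:
  "g \<in> borel_measurable borel \<Longrightarrow> (\<integral>\<^sup>+ x. g x \<partial>design) = (\<integral>\<^sup>+ z. g (fst z) \<partial>P)"
  by (simp add: design_def nn_integral_distr)

lemma prob_space_design: "prob_space design"
  unfolding design_def by (rule prob_space_distr) simp

lemma integrable_bounded_mult:
  fixes h :: "real^'d \<Rightarrow> real"
  assumes [measurable]: "h \<in> borel_measurable borel"
    and "\<And>x. \<bar>h x\<bar> \<le> C" "integrable P k"
  shows "integrable P (\<lambda>z. h (fst z) * k z)"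
proof (rule Bochner_Integration.integrable_bound[of P "\<lambda>z. C * k z"])
  show "(\<lambda>z. h (fst z) * k z) \<in> borel_measurable P" using assms(3) by measurable
  show "AE z in P. norm (h (fst z) * k z) \<le> norm (C * k z)"
    using assms(2) by (intro AE_I2) (auto simp: abs_mult intro!: mult_right_mono intro: order_trans[OF _ abs_ge_self])
qed (use assms(3) in simp)

text \<open>The positive and negative parts of the noise have equal integrals over every event in
  the covariate, hence also against nonnegative bounded weights.\<close>

lemma integral_bounded_mult_noise:
  fixes g :: "real^'d \<Rightarrow> real"
  assumes [measurable]: "g \<in> borel_measurable borel" and g: "\<And>x. \<bar>g x\<bar> \<le> C"
  shows "(\<integral> z. g (fst z) * snd z \<partial>P) = 0"
proof -
  define ep where "ep = (\<lambda>z::(real^'d) \<times> real. max 0 (snd z))"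
  define em where "em = (\<lambda>z::(real^'d) \<times> real. max 0 (- snd z))"
  have int: "integrable P ep" "integrable P em"
    unfolding ep_def em_def using eps_integrable by auto
  have [measurable]: "ep \<in> borel_measurable P" "em \<in> borel_measurable P"
    using int by auto
  have nonneg: "0 \<le> ep z" "0 \<le> em z" and split: "snd z = ep z - em z" for z
    by (auto simp: ep_def em_def)
  have vanish: "(\<integral> z. h (fst z) * snd z \<partial>P) = 0"
    if h[measurable]: "h \<in> borel_measurable borel" and h0: "\<And>x. 0 \<le> h x" and bd: "\<And>x. \<bar>h x\<bar> \<le> D" for h D
  proof -
    have nn: "(\<integral>\<^sup>+ z. ennreal (k (fst z)) * ennreal (f z) \<partial>P) = ennreal (\<integral> z. k (fst z) * f z \<partial>P)"
      if "k \<in> borel_measurable borel" "\<And>x. 0 \<le> k x" "\<And>x. \<bar>k x\<bar> \<le> E" "integrable P f" "\<And>z. 0 \<le> f z" for k f E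
      using that integrable_bounded_mult[OF that(1,3,4)]
      by (subst nn_integral_eq_integral[symmetric]) (auto simp: ennreal_mult)
    have ind: "ennreal (of_bool c) = of_bool c" for c
      by (cases c) auto
    have "(\<integral>\<^sup>+ z. ennreal (h (fst z)) * ennreal (ep z) \<partial>P) = (\<integral>\<^sup>+ z. ennreal (h (fst z)) * ennreal (em z) \<partial>P)"
    proof (rule nn_integral_weighted_eq[where N = borel and p = fst])
      fix B :: "(real^'d) set" assume B[measurable]: "B \<in> sets borel"
      have i: "integrable P (\<lambda>z. indicator B (fst z) * f z)" if "integrable P f" for f :: "_ \<Rightarrow> real"
        using that by (intro integrable_bounded_mult[where C = 1]) (auto simp: indicator_def)
      have "(\<integral> z. indicator B (fst z) * ep z \<partial>P) - (\<integral> z. indicator B (fst z) * em z \<partial>P) =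
          (\<integral> z. indicator B (fst z) * snd z \<partial>P)"
        unfolding split right_diff_distrib using i int by simp
      then have "(\<integral> z. indicator B (fst z) * ep z \<partial>P) = (\<integral> z. indicator B (fst z) * em z \<partial>P)"
        using eps_mean[OF B] by simp
      then show "(\<integral>\<^sup>+ z. indicator B (fst z) * ennreal (ep z) \<partial>P) = (\<integral>\<^sup>+ z. indicator B (fst z) * ennreal (em z) \<partial>P)"
        using nn[of "indicator B" 1 ep] nn[of "indicator B" 1 em] int nonneg
        by (simp add: ind indicator_def[of B])
    qed auto
    then have "(\<integral> z. h (fst z) * ep z \<partial>P) = (\<integral> z. h (fst z) * em z \<partial>P)"
      unfolding nn[OF h h0 bd int(1) nonneg(1)] nn[OF h h0 bd int(2) nonneg(2)]
      using h0 nonneg by (subst (asm) ennreal_inj) (auto intro!: integral_nonneg_AE)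
    then show ?thesis
      unfolding split right_diff_distrib using integrable_bounded_mult[OF h bd int(1)] integrable_bounded_mult[OF h bd int(2)]
      by simp
  qed
  have "C \<ge> 0"
    using g[of 0] by linarith
  \<comment> \<open>A signed weight is reduced to the nonnegative ones \<open>g x + C\<close> and
    \<open>C\<close>, whose difference it is.\<close>
  have "(\<integral> z. (g (fst z) + C) * snd z \<partial>P) = 0"
    by (rule vanish[of "\<lambda>x. g x + C" "2 * C"])
       (use g in \<open>auto simp: abs_le_iff, insert g, (smt (verit))+\<close>)
  moreover have "(\<integral> z. C * snd z \<partial>P) = 0"
    using vanish[of "\<lambda>x. C" C] \<open>C \<ge> 0\<close> by simp
  ultimately show ?thesis
    unfolding distrib_right using integrable_bounded_mult[OF assms eps_integrable] eps_integrable by auto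
qed

lemma nn_integral_mult_noise_square:
  fixes g :: "real^'d \<Rightarrow> ennreal"
  assumes [measurable]: "g \<in> borel_measurable borel"
  shows "(\<integral>\<^sup>+ z. g (fst z) * ennreal ((snd z)\<^sup>2) \<partial>P) = (\<integral>\<^sup>+ z. g (fst z) * ennreal s \<partial>P)"
proof (rule nn_integral_weighted_eq[where N = borel and p = fst])
  fix B :: "(real^'d) set" assume B[measurable]: "B \<in> sets borel"
  have "(\<integral>\<^sup>+ z. indicator B (fst z) * ennreal ((snd z)\<^sup>2) \<partial>P) = (\<integral>\<^sup>+ z. ennreal (indicator B (fst z) * (snd z)\<^sup>2) \<partial>P)"
    by (intro nn_integral_cong) (simp add: indicator_def)
  also have "\<dots> = ennreal (\<integral> z. indicator B (fst z) * (snd z)\<^sup>2 \<partial>P)"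
    using integrable_bounded_mult[of "indicator B" 1 "\<lambda>z. (snd z)\<^sup>2"] eps_sq
    by (intro nn_integral_eq_integral) (auto simp: indicator_def)
  also have "\<dots> = ennreal (\<integral> z. indicator B (fst z) * s \<partial>P)"
    using eps_var[OF B] by (simp add: mult.commute)
  also have "\<dots> = (\<integral>\<^sup>+ z. ennreal (indicator B (fst z) * s) \<partial>P)"
    using integrable_bounded_mult[of "indicator B" 1 "\<lambda>z. s"] s_nonneg
    by (intro nn_integral_eq_integral[symmetric]) (auto simp: indicator_def)
  also have "\<dots> = (\<integral>\<^sup>+ z. indicator B (fst z) * ennreal s \<partial>P)"
    by (intro nn_integral_cong) (simp add: indicator_def)
  finally show "(\<integral>\<^sup>+ z. indicator B (fst z) * ennreal ((snd z)\<^sup>2) \<partial>P) = (\<integral>\<^sup>+ z. indicator B (fst z) * ennreal s \<partial>P)" .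
qed auto

text \<open>Bounded coefficients keep each term of the expanded square integrable; the cross term
  vanishes by the mean condition and the squared noise is replaced by \<open>s\<close>.\<close>

lemma nn_integral_affine_noise_bounded:
  assumes [measurable]: "a \<in> borel_measurable borel" "b \<in> borel_measurable borel"
    and bd: "\<And>x. \<bar>a x\<bar> \<le> 1" "\<And>x. \<bar>b x\<bar> \<le> 1"
  shows "(\<integral>\<^sup>+ z. ennreal ((a (fst z) + b (fst z) * snd z)\<^sup>2) \<partial>P) =
    (\<integral>\<^sup>+ z. ennreal ((a (fst z))\<^sup>2 + s * (b (fst z))\<^sup>2) \<partial>P)"
proof -
  have ab: "\<bar>a x * b x\<bar> \<le> 1" and aa: "\<bar>(a x)\<^sup>2\<bar> \<le> 1" and bb: "\<bar>(b x)\<^sup>2\<bar> \<le> 1" for x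
    using bd[of x] by (auto simp: abs_mult mult_le_one power_le_one abs_square_le_1)
  have 1: "integrable P (\<lambda>z. (a (fst z))\<^sup>2)"
    using integrable_bounded_mult[of "\<lambda>x. (a x)\<^sup>2" 1 "\<lambda>_. 1"] aa by simp
  have 2: "integrable P (\<lambda>z. a (fst z) * b (fst z) * snd z)"
    using integrable_bounded_mult[of "\<lambda>x. a x * b x" 1, OF _ ab eps_integrable] by simp
  have 3: "integrable P (\<lambda>z. (b (fst z))\<^sup>2 * (snd z)\<^sup>2)"
    using integrable_bounded_mult[of "\<lambda>x. (b x)\<^sup>2" 1, OF _ bb eps_sq] by simp
  have 4: "integrable P (\<lambda>z. (b (fst z))\<^sup>2 * s)"
    using integrable_bounded_mult[of "\<lambda>x. (b x)\<^sup>2" 1 "\<lambda>_. s"] bb by simp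
  have expand: "(a (fst z) + b (fst z) * snd z)\<^sup>2 =
      (a (fst z))\<^sup>2 + 2 * (a (fst z) * b (fst z) * snd z) + (b (fst z))\<^sup>2 * (snd z)\<^sup>2" for z
    by (simp add: power2_eq_square algebra_simps)
  have int: "integrable P (\<lambda>z. (a (fst z) + b (fst z) * snd z)\<^sup>2)"
    unfolding expand using 1 2 3 by simp
  have "(\<integral>\<^sup>+ z. ennreal ((b (fst z))\<^sup>2 * (snd z)\<^sup>2) \<partial>P) = (\<integral>\<^sup>+ z. ennreal ((b (fst z))\<^sup>2 * s) \<partial>P)"
    using nn_integral_mult_noise_square[of "\<lambda>x. ennreal ((b x)\<^sup>2)"] s_nonneg by (simp add: ennreal_mult)
  then have sq: "(\<integral> z. (b (fst z))\<^sup>2 * (snd z)\<^sup>2 \<partial>P) = (\<integral> z. (b (fst z))\<^sup>2 * s \<partial>P)"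
    using 3 4 s_nonneg by (simp add: nn_integral_eq_integral integral_nonneg_AE)
  have cross: "(\<integral> z. a (fst z) * b (fst z) * snd z \<partial>P) = 0"
    using integral_bounded_mult_noise[of "\<lambda>x. a x * b x" 1] ab by simp
  have "(\<integral>\<^sup>+ z. ennreal ((a (fst z) + b (fst z) * snd z)\<^sup>2) \<partial>P) =
      ennreal (\<integral> z. (a (fst z) + b (fst z) * snd z)\<^sup>2 \<partial>P)"
    using int by (intro nn_integral_eq_integral) auto
  also have "(\<integral> z. (a (fst z) + b (fst z) * snd z)\<^sup>2 \<partial>P) = (\<integral> z. (a (fst z))\<^sup>2 + (b (fst z))\<^sup>2 * s \<partial>P)"
    unfolding expand using 1 2 3 4 sq cross by simp
  also have "ennreal \<dots> = (\<integral>\<^sup>+ z. ennreal ((a (fst z))\<^sup>2 + (b (fst z))\<^sup>2 * s) \<partial>P)"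
    using 1 4 s_nonneg by (intro nn_integral_eq_integral[symmetric]) auto
  finally show ?thesis by (simp add: mult.commute)
qed

text \<open>Unbounded coefficients are reduced to bounded ones by normalising with
  \<open>w = 1 + a\<^sup>2 + b\<^sup>2\<close> and reweighting, so no integrability is needed.\<close>

lemma nn_integral_affine_noise:
  assumes [measurable]: "a \<in> borel_measurable borel" "b \<in> borel_measurable borel"
  shows "(\<integral>\<^sup>+ z. ennreal ((a (fst z) + b (fst z) * snd z)\<^sup>2) \<partial>P) =
    (\<integral>\<^sup>+ x. ennreal ((a x)\<^sup>2 + s * (b x)\<^sup>2) \<partial>design)"
proof -
  define w where "w x = 1 + (a x)\<^sup>2 + (b x)\<^sup>2" for x
  define a' where "a' x = a x / sqrt (w x)" for x
  define b' where "b' x = b x / sqrt (w x)" for x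
  have [measurable]: "w \<in> borel_measurable borel" "a' \<in> borel_measurable borel" "b' \<in> borel_measurable borel"
    unfolding w_def a'_def b'_def by measurable
  have w: "w x > 0" for x
    by (simp add: w_def add_pos_nonneg)
  have "\<bar>a x\<bar> \<le> sqrt (w x)" "\<bar>b x\<bar> \<le> sqrt (w x)" for x
    by (auto intro!: real_le_rsqrt simp: w_def)
  then have bd: "\<bar>a' x\<bar> \<le> 1" "\<bar>b' x\<bar> \<le> 1" for x
    using w[of x] by (auto simp: a'_def b'_def abs_mult)
  have "(\<integral>\<^sup>+ z. ennreal (w (fst z)) * ennreal ((a' (fst z) + b' (fst z) * snd z)\<^sup>2) \<partial>P) =
      (\<integral>\<^sup>+ z. ennreal (w (fst z)) * ennreal ((a' (fst z))\<^sup>2 + s * (b' (fst z))\<^sup>2) \<partial>P)"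
  proof (rule nn_integral_weighted_eq[where N = borel and p = fst])
    fix B :: "(real^'d) set" assume B[measurable]: "B \<in> sets borel"
    \<comment> \<open>Multiplying both coefficients by the indicator of \<open>B\<close> keeps them
      bounded by 1, so the bounded case covers the restriction to each event.\<close>
    have "(\<integral>\<^sup>+ z. indicator B (fst z) * ennreal ((a' (fst z) + b' (fst z) * snd z)\<^sup>2) \<partial>P) =
        (\<integral>\<^sup>+ z. ennreal ((indicator B (fst z) * a' (fst z) + indicator B (fst z) * b' (fst z) * snd z)\<^sup>2) \<partial>P)"
      by (intro nn_integral_cong) (simp add: indicator_def)
    also have "\<dots> = (\<integral>\<^sup>+ z. ennreal ((indicator B (fst z) * a' (fst z))\<^sup>2 + s * (indicator B (fst z) * b' (fst z))\<^sup>2) \<partial>P)"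
      using bd by (intro nn_integral_affine_noise_bounded) (auto simp: indicator_def)
    also have "\<dots> = (\<integral>\<^sup>+ z. indicator B (fst z) * ennreal ((a' (fst z))\<^sup>2 + s * (b' (fst z))\<^sup>2) \<partial>P)"
      by (intro nn_integral_cong) (simp add: indicator_def)
    finally show "(\<integral>\<^sup>+ z. indicator B (fst z) * ennreal ((a' (fst z) + b' (fst z) * snd z)\<^sup>2) \<partial>P) =
        (\<integral>\<^sup>+ z. indicator B (fst z) * ennreal ((a' (fst z))\<^sup>2 + s * (b' (fst z))\<^sup>2) \<partial>P)" .
  qed auto
  moreover have "ennreal (w x) * ennreal ((a' x + b' x * e)\<^sup>2) = ennreal ((a x + b x * e)\<^sup>2)" for x e
  proof -
    have "a' x + b' x * e = (a x + b x * e) / sqrt (w x)"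
      by (simp add: a'_def b'_def add_divide_distrib)
    then show ?thesis
      using w[of x] by (simp add: power_divide ennreal_mult[symmetric])
  qed
  moreover have "ennreal (w x) * ennreal ((a' x)\<^sup>2 + s * (b' x)\<^sup>2) = ennreal ((a x)\<^sup>2 + s * (b x)\<^sup>2)" for x
  proof -
    have "(a' x)\<^sup>2 + s * (b' x)\<^sup>2 = ((a x)\<^sup>2 + s * (b x)\<^sup>2) / w x"
      using w[of x] by (simp add: a'_def b'_def power_divide add_divide_distrib)
    then show ?thesis
      using w[of x] s_nonneg by (simp add: ennreal_mult[symmetric])
  qed
  ultimately show ?thesis
    by (simp add: design_def nn_integral_distr)
qed

lemma measurable_PiM_design: "measurable (PiM I (\<lambda>_. design)) M = measurable (PiM I (\<lambda>_. borel)) M"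
  by (intro measurable_cong_sets sets_PiM_cong) auto

text \<open>Training noises are integrated out one at a time by induction on the index set. The
  nonnegative term \<open>c\<close> generalises the claim: it carries the variance contributions of
  the samples already treated.\<close>

lemma nn_integral_PiM_affine_noise:
  fixes a :: "('i \<Rightarrow> real^'d) \<Rightarrow> real" and c :: "('i \<Rightarrow> real^'d) \<Rightarrow> ennreal"
  assumes "finite I"
    and "a \<in> borel_measurable (PiM I (\<lambda>_. borel))"
    and "\<And>i. i \<in> I \<Longrightarrow> b i \<in> borel_measurable (PiM I (\<lambda>_. borel))"
    and "c \<in> borel_measurable (PiM I (\<lambda>_. borel))"
  shows "(\<integral>\<^sup>+ zs. ennreal ((a (\<lambda>j\<in>I. fst (zs j)) + (\<Sum>i\<in>I. b i (\<lambda>j\<in>I. fst (zs j)) * snd (zs i)))\<^sup>2)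
            + c (\<lambda>j\<in>I. fst (zs j)) \<partial>PiM I (\<lambda>_. P)) =
         (\<integral>\<^sup>+ xs. ennreal ((a xs)\<^sup>2 + s * (\<Sum>i\<in>I. (b i xs)\<^sup>2)) + c xs \<partial>PiM I (\<lambda>_. design))"
  using assms
proof (induction I arbitrary: a b c)
  case empty
  then show ?case
    by (simp add: PiM_empty nn_integral_count_space_finite restrict_def)
next
  case (insert i I)
  interpret D: prob_space design by (rule prob_space_design)
  interpret PP: product_prob_space "\<lambda>_::'i. P" by standard
  interpret DD: product_prob_space "\<lambda>_::'i. design" by standard
  interpret PI: prob_space "PiM I (\<lambda>_. P)" by (rule prob_space_PiM) (rule prob)
  interpret PD: pair_sigma_finite "PiM I (\<lambda>_. P)" design ..
  note [simp] = \<open>finite I\<close> \<open>i \<notin> I\<close>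
  have neq: "j \<noteq> i" if "j \<in> I" for j
    using that \<open>i \<notin> I\<close> by auto
  define pr where "pr zs = (\<lambda>j\<in>I. fst (zs j))" for zs :: "'i \<Rightarrow> (real^'d) \<times> real"
  have pr_upd: "(\<lambda>j\<in>insert i I. fst ((zs(i := y)) j)) = (pr zs)(i := fst y)" for zs y
    by (auto simp: pr_def fun_eq_iff)
  have pr_M[measurable]: "pr \<in> measurable (PiM I (\<lambda>_. P)) (PiM I (\<lambda>_. borel))"
    unfolding pr_def by measurable
  note [measurable] = insert.prems(1,3)
  note bM = insert.prems(2)
  have bi[measurable]: "b i \<in> borel_measurable (PiM (insert i I) (\<lambda>_. borel))"
    by (rule bM) simp
  have bM'[measurable]: "b j \<in> borel_measurable (PiM (insert i I) (\<lambda>_. borel))" if "j \<in> I" for j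
    by (rule bM) (use that in simp)
  have upd[measurable]: "(\<lambda>(xs, x). xs(i := x)) \<in> measurable (PiM I (\<lambda>_. borel) \<Otimes>\<^sub>M borel) (PiM (insert i I) (\<lambda>_. borel))"
    by (rule measurable_add_dim)
  \<comment> \<open>The coefficients depend on all covariates but on no noise. With the other
    samples and the covariate \<open>x\<close> at \<open>i\<close> fixed, the expression is affine
    in the noise at \<open>i\<close>, with constant term \<open>A zs x\<close>.\<close>
  define A where "A zs x = a ((pr zs)(i := x)) + (\<Sum>j\<in>I. b j ((pr zs)(i := x)) * snd (zs j))" for zs x
  have updP[measurable]: "(\<lambda>(zs, x). (pr zs)(i := x)) \<in> measurable (PiM I (\<lambda>_. P) \<Otimes>\<^sub>M borel) (PiM (insert i I) (\<lambda>_. borel))"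
    using measurable_compose[OF _ upd, of "\<lambda>(zs, x). (pr zs, x)" "PiM I (\<lambda>_. P) \<Otimes>\<^sub>M borel"]
    by (simp add: split_beta')
  have updP': "(\<lambda>x. (pr zs)(i := x)) \<in> measurable borel (PiM (insert i I) (\<lambda>_. borel))"
    if "zs \<in> space (PiM I (\<lambda>_. P))" for zs
    using measurable_compose[OF measurable_Pair1'[OF that] updP] by simp
  have A_M: "(\<lambda>(zs, x). A zs x) \<in> borel_measurable (PiM I (\<lambda>_. P) \<Otimes>\<^sub>M borel)"
    unfolding A_def split_beta'
    using updP by (intro borel_measurable_add borel_measurable_sum borel_measurable_times
      measurable_compose[OF updP[unfolded split_beta'] insert.prems(1)]
      measurable_compose[OF updP[unfolded split_beta'] bM'])  measurable
  have "(\<integral>\<^sup>+ zs. ennreal ((a (\<lambda>j\<in>insert i I. fst (zs j))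
        + (\<Sum>k\<in>insert i I. b k (\<lambda>j\<in>insert i I. fst (zs j)) * snd (zs k)))\<^sup>2)
            + c (\<lambda>j\<in>insert i I. fst (zs j)) \<partial>PiM (insert i I) (\<lambda>_. P)) =
    (\<integral>\<^sup>+ zs. (\<integral>\<^sup>+ y. ennreal ((A zs (fst y) + b i ((pr zs)(i := fst y)) * snd y)\<^sup>2)
            + c ((pr zs)(i := fst y)) \<partial>P) \<partial>PiM I (\<lambda>_. P))"
    apply (subst PP.product_nn_integral_insert)
    subgoal by simp
    subgoal by simp
    subgoal
      by (intro borel_measurable_add measurable_compose[OF _ measurable_ennreal] borel_measurable_power borel_measurable_sum
          borel_measurable_times measurable_compose[OF measurable_restrict[where X="\<lambda>j zs. fst (zs j)" and M = "\<lambda>_. borel"] bM]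
          measurable_compose[OF measurable_restrict[where X="\<lambda>j zs. fst (zs j)" and M = "\<lambda>_. borel"] insert.prems(1)]
          measurable_compose[OF measurable_restrict[where X="\<lambda>j zs. fst (zs j)" and M = "\<lambda>_. borel"] insert.prems(3)])
         measurable
    subgoal
      unfolding pr_upd
      by (simp add: A_def neq add_ac cong: sum.cong)
    done
  also have "\<dots> = (\<integral>\<^sup>+ zs. (\<integral>\<^sup>+ x. ennreal ((A zs x)\<^sup>2 + s * (b i ((pr zs)(i := x)))\<^sup>2)
            + c ((pr zs)(i := x)) \<partial>design) \<partial>PiM I (\<lambda>_. P))"
  proof (rule nn_integral_cong)
    fix zs assume zs: "zs \<in> space (PiM I (\<lambda>_. P))"
    note [measurable] = updP'[OF zs]
    have [measurable]: "A zs \<in> borel_measurable borel"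
      using measurable_compose[OF measurable_Pair1'[OF zs] A_M] by simp
    show "(\<integral>\<^sup>+ y. ennreal ((A zs (fst y) + b i ((pr zs)(i := fst y)) * snd y)\<^sup>2) + c ((pr zs)(i := fst y)) \<partial>P) =
      (\<integral>\<^sup>+ x. ennreal ((A zs x)\<^sup>2 + s * (b i ((pr zs)(i := x)))\<^sup>2) + c ((pr zs)(i := x)) \<partial>design)"
      using nn_integral_affine_noise[of "A zs" "\<lambda>x. b i ((pr zs)(i := x))"]
        nn_integral_design[of "\<lambda>x. c ((pr zs)(i := x))"]
      by (simp add: nn_integral_add)
  qed
  \<comment> \<open>The covariate at \<open>i\<close> is moved to the outer integral, so that the
    induction hypothesis applies to the remaining samples with \<open>x\<close> held fixed.\<close>
  also have "\<dots> = (\<integral>\<^sup>+ x. (\<integral>\<^sup>+ zs. ennreal ((A zs x)\<^sup>2 + s * (b i ((pr zs)(i := x)))\<^sup>2)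
            + c ((pr zs)(i := x)) \<partial>PiM I (\<lambda>_. P)) \<partial>design)"
  proof (rule PD.Fubini'[symmetric])
    note [measurable] = A_M
    have [measurable]: "(\<lambda>p. b i ((pr (fst p))(i := snd p))) \<in> borel_measurable (PiM I (\<lambda>_. P) \<Otimes>\<^sub>M borel)"
       "(\<lambda>p. c ((pr (fst p))(i := snd p))) \<in> borel_measurable (PiM I (\<lambda>_. P) \<Otimes>\<^sub>M borel)"
      using bi insert.prems(3) by (auto intro: measurable_compose[OF updP[unfolded split_beta']])
    show "(\<lambda>(zs, x). ennreal ((A zs x)\<^sup>2 + s * (b i ((pr zs)(i := x)))\<^sup>2) + c ((pr zs)(i := x)))
        \<in> borel_measurable (PiM I (\<lambda>_. P) \<Otimes>\<^sub>M design)"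
      unfolding split_beta' by measurable
  qed
  also have "\<dots> = (\<integral>\<^sup>+ x. (\<integral>\<^sup>+ xs. ennreal ((a (xs(i := x)))\<^sup>2 + s * (\<Sum>j\<in>I. (b j (xs(i := x)))\<^sup>2))
            + (ennreal (s * (b i (xs(i := x)))\<^sup>2) + c (xs(i := x))) \<partial>PiM I (\<lambda>_. design)) \<partial>design)"
  proof (rule nn_integral_cong)
    fix x :: "real^'d"
    have [measurable]: "(\<lambda>xs. xs(i := x)) \<in> measurable (PiM I (\<lambda>_. borel)) (PiM (insert i I) (\<lambda>_. borel))"
      using measurable_compose[OF measurable_Pair2' upd, of x] by simp
    have "(\<integral>\<^sup>+ zs. ennreal ((A zs x)\<^sup>2 + s * (b i ((pr zs)(i := x)))\<^sup>2) + c ((pr zs)(i := x)) \<partial>PiM I (\<lambda>_. P)) =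
      (\<integral>\<^sup>+ zs. ennreal ((A zs x)\<^sup>2) + (ennreal (s * (b i ((pr zs)(i := x)))\<^sup>2) + c ((pr zs)(i := x))) \<partial>PiM I (\<lambda>_. P))"
      using s_nonneg by (intro nn_integral_cong) (simp add: add_ac)
    \<comment> \<open>Induction hypothesis with the variance term of sample \<open>i\<close> added
      to \<open>c\<close>.\<close>
    also have "\<dots> = (\<integral>\<^sup>+ xs. ennreal ((a (xs(i := x)))\<^sup>2 + s * (\<Sum>j\<in>I. (b j (xs(i := x)))\<^sup>2))
            + (ennreal (s * (b i (xs(i := x)))\<^sup>2) + c (xs(i := x))) \<partial>PiM I (\<lambda>_. design))"
      unfolding A_def pr_def
      by (rule insert.IH[of "\<lambda>xs. a (xs(i := x))" "\<lambda>j xs. b j (xs(i := x))"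
            "\<lambda>xs. ennreal (s * (b i (xs(i := x)))\<^sup>2) + c (xs(i := x))"]) measurable
    finally show "(\<integral>\<^sup>+ zs. ennreal ((A zs x)\<^sup>2 + s * (b i ((pr zs)(i := x)))\<^sup>2) + c ((pr zs)(i := x)) \<partial>PiM I (\<lambda>_. P)) = \<dots>" .
  qed
  also have "\<dots> = (\<integral>\<^sup>+ xs. ennreal ((a xs)\<^sup>2 + s * (\<Sum>j\<in>insert i I. (b j xs)\<^sup>2)) + c xs \<partial>PiM (insert i I) (\<lambda>_. design))"
    apply (subst DD.product_nn_integral_insert_rev)
    subgoal by simp
    subgoal by simp
    subgoal
      unfolding measurable_PiM_design using bM insert.prems(1,3)
      by (intro borel_measurable_add measurable_compose[OF _ measurable_ennreal] borel_measurable_power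
          borel_measurable_sum borel_measurable_times borel_measurable_const) auto
    subgoal
      using s_nonneg
      by (intro nn_integral_cong) (simp add: distrib_left sum_nonneg add_ac flip: ennreal_plus)
    done
  finally show ?case .
qed

section \<open>Prediction risk and Bayes risk in terms of the covariates\<close>

lemma sets_P_pair[measurable_cong]: "sets P = sets (borel \<Otimes>\<^sub>M borel)"
  unfolding borel_prod by (rule sets_P)

text \<open>The prediction error is affine in all noises: training noise i has coefficient minus the
  i-th weight and the test noise has coefficient 1. Integrating them out leaves the squared bias,
  \<open>s\<close> times the squared weights, and \<open>s\<close> for the test response.\<close>

lemma lin_risk_eq:
  fixes l :: "nat \<Rightarrow> ((real^'d) \<times> (nat \<Rightarrow> real^'d) \<times> 'r) \<Rightarrow> real"
  assumes l[measurable]: "\<And>i. l i \<in> borel_measurable (borel \<Otimes>\<^sub>M (PiM {..<n} (\<lambda>_. borel) \<Otimes>\<^sub>M R))"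
    and R: "prob_space R"
  shows "lin_risk n P R l \<theta> =
    (\<integral>\<^sup>+ (x, xs, u). ennreal (((x - (\<Sum>i<n. l i (x, xs, u) *\<^sub>R xs i)) \<bullet> \<theta>)\<^sup>2
        + s * (\<Sum>i<n. (l i (x, xs, u))\<^sup>2) + s)
      \<partial>(design \<Otimes>\<^sub>M (PiM {..<n} (\<lambda>_. design) \<Otimes>\<^sub>M R)))"
proof -
  interpret D: prob_space design by (rule prob_space_design)
  interpret R: prob_space R by (rule R)
  interpret PI: prob_space "PiM {..<n} (\<lambda>_. P)" by (rule prob_space_PiM) (rule prob)
  interpret DI: prob_space "PiM {..<n} (\<lambda>_. design)" by (rule prob_space_PiM) (rule prob_space_design)
  interpret PIR: pair_prob_space "PiM {..<n} (\<lambda>_. P)" R ..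
  interpret DIR: pair_prob_space "PiM {..<n} (\<lambda>_. design)" R ..
  interpret P2: pair_prob_space P "PiM {..<n} (\<lambda>_. design) \<Otimes>\<^sub>M R" ..
  interpret D2: pair_prob_space design "PiM {..<n} (\<lambda>_. design) \<Otimes>\<^sub>M R" ..
  define A where "A x q = (x - (\<Sum>i<n. l i (x, q) *\<^sub>R fst q i)) \<bullet> \<theta>" for x and q :: "(nat \<Rightarrow> real^'d) \<times> 'r"
  define B where "B x q = s * (\<Sum>i<n. (l i (x, q))\<^sup>2)" for x and q :: "(nat \<Rightarrow> real^'d) \<times> 'r"
  define T where "T zs = (\<lambda>j\<in>{..<n}. fst (zs j))" for zs :: "nat \<Rightarrow> (real^'d) \<times> real"
  have T[measurable]: "T \<in> measurable (PiM {..<n} (\<lambda>_. P)) (PiM {..<n} (\<lambda>_. borel))"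
    unfolding T_def by measurable
  have A: "(\<lambda>(x, q). A x q) \<in> borel_measurable (borel \<Otimes>\<^sub>M (PiM {..<n} (\<lambda>_. borel) \<Otimes>\<^sub>M R))"
    and B: "(\<lambda>(x, q). B x q) \<in> borel_measurable (borel \<Otimes>\<^sub>M (PiM {..<n} (\<lambda>_. borel) \<Otimes>\<^sub>M R))"
    unfolding A_def B_def by measurable
  note [measurable] = A B
  have B0: "0 \<le> B x q" for x q
    using s_nonneg by (auto simp: B_def intro!: mult_nonneg_nonneg sum_nonneg)
  have F: "(\<lambda>w. ennreal ((fst (fst w) \<bullet> \<theta> + snd (fst w)
      - (\<Sum>i<n. l i (fst (fst w), T (fst (snd w)), snd (snd w)) * (fst (fst (snd w) i) \<bullet> \<theta> + snd (fst (snd w) i))))\<^sup>2))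
      \<in> borel_measurable (P \<Otimes>\<^sub>M (PiM {..<n} (\<lambda>_. P) \<Otimes>\<^sub>M R))"
    by measurable
  have G: "(\<lambda>(x, q). ennreal ((A x q)\<^sup>2 + B x q + s)) \<in> borel_measurable (design \<Otimes>\<^sub>M (PiM {..<n} (\<lambda>_. design) \<Otimes>\<^sub>M R))"
    by measurable
  have "lin_risk n P R l \<theta> =
    (\<integral>\<^sup>+ z. (\<integral>\<^sup>+ q. ennreal ((fst z \<bullet> \<theta> + snd z
          - (\<Sum>i<n. l i (fst z, T (fst q), snd q) * (fst (fst q i) \<bullet> \<theta> + snd (fst q i)))) ^ 2)
      \<partial>(PiM {..<n} (\<lambda>_. P) \<Otimes>\<^sub>M R)) \<partial>P)"
    unfolding lin_risk_def split_beta' T_def[symmetric]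
    by (subst PIR.nn_integral_fst[symmetric]) (simp_all add: F)
  also have "\<dots> = (\<integral>\<^sup>+ z. (\<integral>\<^sup>+ q. ennreal ((A (fst z) q + snd z)\<^sup>2 + B (fst z) q)
      \<partial>(PiM {..<n} (\<lambda>_. design) \<Otimes>\<^sub>M R)) \<partial>P)"
  proof (rule nn_integral_cong)
    fix z :: "(real^'d) \<times> real"
    show "(\<integral>\<^sup>+ q. ennreal ((fst z \<bullet> \<theta> + snd z
          - (\<Sum>i<n. l i (fst z, T (fst q), snd q) * (fst (fst q i) \<bullet> \<theta> + snd (fst q i)))) ^ 2)
          \<partial>(PiM {..<n} (\<lambda>_. P) \<Otimes>\<^sub>M R)) =
        (\<integral>\<^sup>+ q. ennreal ((A (fst z) q + snd z)\<^sup>2 + B (fst z) q) \<partial>(PiM {..<n} (\<lambda>_. design) \<Otimes>\<^sub>M R))"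
      apply (subst PIR.nn_integral_snd[symmetric])
      subgoal by measurable
      apply (subst DIR.nn_integral_snd[symmetric])
      subgoal by measurable
    proof (rule nn_integral_cong, goal_cases)
      case (1 u)
      note u[measurable] = 1
      have [measurable]: "(\<lambda>xs. l i (fst z, xs, u)) \<in> borel_measurable (PiM {..<n} (\<lambda>_. borel))" for i
        by measurable
      have [measurable]: "(\<lambda>xs. A (fst z) (xs, u)) \<in> borel_measurable (PiM {..<n} (\<lambda>_. borel))"
        by measurable
      \<comment> \<open>For a fixed test pair and seed \<open>u\<close>, the test noise is part of
        the constant term while the training noises are averaged.\<close>
      have eq: "fst z \<bullet> \<theta> + snd z - (\<Sum>i<n. l i (fst z, T zs, u) * (fst (zs i) \<bullet> \<theta> + snd (zs i))) =
          (A (fst z) (T zs, u) + snd z) + (\<Sum>i<n. - l i (fst z, T zs, u) * snd (zs i))" for zs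
        by (simp add: A_def T_def inner_diff_left inner_sum_left distrib_left sum.distrib sum_negf)
      show ?case
        using nn_integral_PiM_affine_noise[of "{..<n}" "\<lambda>xs. A (fst z) (xs, u) + snd z" "\<lambda>i xs. - l i (fst z, xs, u)" "\<lambda>_. 0"]
        by (simp add: eq T_def[symmetric] B_def)
    qed
  qed
  \<comment> \<open>The test pair becomes the inner variable, so that its noise can be integrated
    for fixed training covariates and seed.\<close>
  also have "\<dots> = (\<integral>\<^sup>+ q. (\<integral>\<^sup>+ z. ennreal ((A (fst z) q + snd z)\<^sup>2 + B (fst z) q) \<partial>P)
      \<partial>(PiM {..<n} (\<lambda>_. design) \<Otimes>\<^sub>M R))"
    by (rule P2.Fubini'[symmetric]) measurable
  also have "\<dots> = (\<integral>\<^sup>+ q. (\<integral>\<^sup>+ x. ennreal ((A x q)\<^sup>2 + B x q + s) \<partial>design)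
      \<partial>(PiM {..<n} (\<lambda>_. design) \<Otimes>\<^sub>M R))"
  proof (rule nn_integral_cong)
    fix q assume q: "q \<in> space (PiM {..<n} (\<lambda>_. design) \<Otimes>\<^sub>M R)"
    have q': "q \<in> space (PiM {..<n} (\<lambda>_. borel :: (real^'d) measure) \<Otimes>\<^sub>M R)"
      using q by (simp add: space_pair_measure space_PiM design_def)
    have [measurable]: "(\<lambda>x. A x q) \<in> borel_measurable borel" "(\<lambda>x. B x q) \<in> borel_measurable borel"
      using measurable_compose[OF measurable_Pair2'[OF q'] A] measurable_compose[OF measurable_Pair2'[OF q'] B] by auto
    have "(\<integral>\<^sup>+ z. ennreal ((A (fst z) q + snd z)\<^sup>2 + B (fst z) q) \<partial>P) =
        (\<integral>\<^sup>+ z. ennreal ((A (fst z) q + 1 * snd z)\<^sup>2) \<partial>P) + (\<integral>\<^sup>+ z. ennreal (B (fst z) q) \<partial>P)"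
      using B0 by (subst nn_integral_add[symmetric]) (auto simp: ennreal_plus)
    also have "\<dots> = (\<integral>\<^sup>+ x. ennreal ((A x q)\<^sup>2 + s * 1\<^sup>2) \<partial>design) + (\<integral>\<^sup>+ x. ennreal (B x q) \<partial>design)"
      using nn_integral_affine_noise[of "\<lambda>x. A x q" "\<lambda>_. 1"] nn_integral_design[of "\<lambda>x. ennreal (B x q)"] by simp
    also have "\<dots> = (\<integral>\<^sup>+ x. ennreal ((A x q)\<^sup>2 + B x q + s) \<partial>design)"
      using B0 s_nonneg by (subst nn_integral_add[symmetric]) (auto simp: ennreal_plus[symmetric] add_ac simp del: ennreal_plus)
    finally show "(\<integral>\<^sup>+ z. ennreal ((A (fst z) q + snd z)\<^sup>2 + B (fst z) q) \<partial>P) = (\<integral>\<^sup>+ x. ennreal ((A x q)\<^sup>2 + B x q + s) \<partial>design)" .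
  qed
  also have "\<dots> = (\<integral>\<^sup>+ (x, q). ennreal ((A x q)\<^sup>2 + B x q + s) \<partial>(design \<Otimes>\<^sub>M (PiM {..<n} (\<lambda>_. design) \<Otimes>\<^sub>M R)))"
    using D2.nn_integral_snd[OF G] by simp
  finally show ?thesis
    unfolding split_beta' A_def B_def by simp
qed

text \<open>Only the squared bias involves the parameter, and by Fubini its average is the
  second-moment form \<open>Q\<close> of the prior at the bias vector.\<close>

lemma bayes_risk_eq:
  fixes l :: "nat \<Rightarrow> ((real^'d) \<times> (nat \<Rightarrow> real^'d) \<times> 'r) \<Rightarrow> real" and \<nu> :: "(real^'d) measure"
  assumes l[measurable]: "\<And>i. l i \<in> borel_measurable (borel \<Otimes>\<^sub>M (PiM {..<n} (\<lambda>_. borel) \<Otimes>\<^sub>M R))"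
    and R: "prob_space R"
    and \<nu>: "prob_space \<nu>" "sets \<nu> = sets borel"
    and Q: "\<And>w. (\<integral>\<^sup>+ \<theta>. ennreal ((w \<bullet> \<theta>)\<^sup>2) \<partial>\<nu>) = ennreal (Q w)" "\<And>w. 0 \<le> Q w"
  shows "(\<integral>\<^sup>+ \<theta>. lin_risk n P R l \<theta> \<partial>\<nu>) =
    (\<integral>\<^sup>+ (x, xs, u). ennreal (Q (x - (\<Sum>i<n. l i (x, xs, u) *\<^sub>R xs i))
        + s * (\<Sum>i<n. (l i (x, xs, u))\<^sup>2) + s)
      \<partial>(design \<Otimes>\<^sub>M (PiM {..<n} (\<lambda>_. design) \<Otimes>\<^sub>M R)))"
proof -
  interpret D: prob_space design by (rule prob_space_design)
  interpret R: prob_space R by (rule R)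
  interpret V: prob_space \<nu> by (rule \<nu>(1))
  interpret DI: prob_space "PiM {..<n} (\<lambda>_. design)" by (rule prob_space_PiM) (rule prob_space_design)
  interpret DIR: pair_prob_space "PiM {..<n} (\<lambda>_. design)" R ..
  interpret D2: pair_prob_space design "PiM {..<n} (\<lambda>_. design) \<Otimes>\<^sub>M R" ..
  let ?W = "design \<Otimes>\<^sub>M (PiM {..<n} (\<lambda>_. design) \<Otimes>\<^sub>M R)"
  interpret VW: pair_prob_space \<nu> ?W ..
  define A where "A w = fst w - (\<Sum>i<n. l i w *\<^sub>R fst (snd w) i)" for w :: "(real^'d) \<times> (nat \<Rightarrow> real^'d) \<times> 'r"
  define B where "B w = s * (\<Sum>i<n. (l i w)\<^sup>2) + s" for w :: "(real^'d) \<times> (nat \<Rightarrow> real^'d) \<times> 'r"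
  have [measurable]: "A \<in> borel_measurable ?W" "B \<in> borel_measurable ?W"
    unfolding A_def B_def by measurable
  note [measurable_cong] = \<nu>(2)
  have B0: "0 \<le> B w" for w
    using s_nonneg by (auto simp: B_def intro!: add_nonneg_nonneg mult_nonneg_nonneg sum_nonneg)
  have "(\<integral>\<^sup>+ \<theta>. lin_risk n P R l \<theta> \<partial>\<nu>) = (\<integral>\<^sup>+ \<theta>. (\<integral>\<^sup>+ w. ennreal ((A w \<bullet> \<theta>)\<^sup>2 + B w) \<partial>?W) \<partial>\<nu>)"
    unfolding lin_risk_eq[OF l R] split_beta' A_def B_def by (simp add: add_ac)
  also have "\<dots> = (\<integral>\<^sup>+ w. (\<integral>\<^sup>+ \<theta>. ennreal ((A w \<bullet> \<theta>)\<^sup>2 + B w) \<partial>\<nu>) \<partial>?W)"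
    by (rule VW.Fubini'[symmetric]) measurable
  also have "\<dots> = (\<integral>\<^sup>+ w. ennreal (Q (A w) + B w) \<partial>?W)"
  proof (rule nn_integral_cong)
    fix w
    have "(\<integral>\<^sup>+ \<theta>. ennreal ((A w \<bullet> \<theta>)\<^sup>2 + B w) \<partial>\<nu>) = (\<integral>\<^sup>+ \<theta>. ennreal ((A w \<bullet> \<theta>)\<^sup>2) + ennreal (B w) \<partial>\<nu>)"
      using B0 by simp
    also have "\<dots> = ennreal (Q (A w) + B w)"
      using B0 Q(2) by (subst nn_integral_add) (auto simp: Q(1) V.emeasure_space_1)
    finally show "(\<integral>\<^sup>+ \<theta>. ennreal ((A w \<bullet> \<theta>)\<^sup>2 + B w) \<partial>\<nu>) = ennreal (Q (A w) + B w)" .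
  qed
  finally show ?thesis
    unfolding split_beta' A_def B_def by (simp add: add_ac)
qed

section \<open>Comparison of the noisy and the noiseless problem\<close>

lemma nn_integral_drop_randomness:
  assumes R: "prob_space R"
    and f: "(\<lambda>(x, xs). f x xs) \<in> borel_measurable (borel \<Otimes>\<^sub>M PiM {..<n} (\<lambda>_. borel))"
  shows "(\<integral>\<^sup>+ (x, xs, u). f x xs \<partial>(design \<Otimes>\<^sub>M (PiM {..<n} (\<lambda>_. design) \<Otimes>\<^sub>M R))) =
    (\<integral>\<^sup>+ x. (\<integral>\<^sup>+ xs. f x xs \<partial>PiM {..<n} (\<lambda>_. design)) \<partial>design)"
proof -
  interpret R: prob_space R by (rule R)
  interpret D: prob_space design by (rule prob_space_design)
  interpret DI: prob_space "PiM {..<n} (\<lambda>_. design)" by (rule prob_space_PiM) (rule prob_space_design)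
  interpret DIR: pair_prob_space "PiM {..<n} (\<lambda>_. design)" R ..
  note [measurable] = f
  have "(\<integral>\<^sup>+ (x, xs, u). f x xs \<partial>(design \<Otimes>\<^sub>M (PiM {..<n} (\<lambda>_. design) \<Otimes>\<^sub>M R))) =
      (\<integral>\<^sup>+ x. (\<integral>\<^sup>+ q. f x (fst q) \<partial>(PiM {..<n} (\<lambda>_. design) \<Otimes>\<^sub>M R)) \<partial>design)"
    unfolding split_beta' by (subst DIR.nn_integral_fst[symmetric]) auto
  also have "\<dots> = (\<integral>\<^sup>+ x. (\<integral>\<^sup>+ xs. f x xs \<partial>PiM {..<n} (\<lambda>_. design)) \<partial>design)"
    by (intro nn_integral_cong, subst R.nn_integral_fst[symmetric]) (auto simp: R.emeasure_space_1)
  finally show ?thesis .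
qed

text \<open>Once noise and parameter are averaged, the integrand at each covariate configuration and
  seed is a ridge objective for the vectors transformed by \<open>T\<close>. Its pointwise minimum
  bounds every rule, whatever its randomness.\<close>

lemma Ebar_ge_ridge:
  fixes \<nu> :: "(real^'d) measure" and T :: "real^'d^'d" and Rty :: "'r itself" and n :: nat
  assumes \<nu>: "prob_space \<nu>" "sets \<nu> = sets borel"
    and T: "\<And>w. (\<integral>\<^sup>+ \<theta>. ennreal ((w \<bullet> \<theta>)\<^sup>2) \<partial>\<nu>) = ennreal ((norm (T *v w))\<^sup>2)"
    and s: "s > 0"
  defines "u \<equiv> \<lambda>x xs. ridge_dual n s (\<lambda>i. T *v xs i) (T *v x)"
  shows "enn2ereal (\<integral>\<^sup>+ x. (\<integral>\<^sup>+ xs. ennreal ((norm (s *\<^sub>R u x xs))\<^sup>2 + s * (\<Sum>i<n. ((T *v xs i) \<bullet> u x xs)\<^sup>2) + s)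
      \<partial>PiM {..<n} (\<lambda>_. design)) \<partial>design) - ereal s \<le> Ebar Rty n P \<nu> s"
  unfolding Ebar_def
proof (intro ereal_minus_mono order_refl INF_greatest, safe)
  fix R :: "'r measure" and l :: "nat \<Rightarrow> ((real^'d) \<times> (nat \<Rightarrow> real^'d) \<times> 'r) \<Rightarrow> real"
  assume R: "prob_space R" and l: "l \<in> linear_rules n R"
  \<comment> \<open>\<open>linear_rules\<close> constrains only the weights below \<open>n\<close>.
    The others do not enter the risk and are set to 0 to obtain a family measurable at every
    index.\<close>
  define k where "k i = (if i < n then l i else (\<lambda>_. 0))" for i
  have k: "k i \<in> borel_measurable (borel \<Otimes>\<^sub>M (PiM {..<n} (\<lambda>_. borel) \<Otimes>\<^sub>M R))" for i
    using l by (auto simp: k_def linear_rules_def)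
  have lk: "lin_risk n P R l \<theta> = lin_risk n P R k \<theta>" for \<theta>
    by (simp add: lin_risk_def k_def)
  have um: "(\<lambda>p. u (fst p) (snd p)) \<in> borel_measurable (borel \<Otimes>\<^sub>M PiM {..<n} (\<lambda>_. borel))"
    unfolding u_def by (rule borel_measurable_ridge_dual) measurable
  have meas: "(\<lambda>(x, xs). ennreal ((norm (s *\<^sub>R u x xs))\<^sup>2 + s * (\<Sum>i<n. ((T *v xs i) \<bullet> u x xs)\<^sup>2) + s))
      \<in> borel_measurable (borel \<Otimes>\<^sub>M PiM {..<n} (\<lambda>_. borel))"
    unfolding split_beta' using um by measurable
  have "(\<integral>\<^sup>+ x. (\<integral>\<^sup>+ xs. ennreal ((norm (s *\<^sub>R u x xs))\<^sup>2 + s * (\<Sum>i<n. ((T *v xs i) \<bullet> u x xs)\<^sup>2) + s)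
      \<partial>PiM {..<n} (\<lambda>_. design)) \<partial>design) =
    (\<integral>\<^sup>+ (x, xs, r). ennreal ((norm (s *\<^sub>R u x xs))\<^sup>2 + s * (\<Sum>i<n. ((T *v xs i) \<bullet> u x xs)\<^sup>2) + s)
      \<partial>(design \<Otimes>\<^sub>M (PiM {..<n} (\<lambda>_. design) \<Otimes>\<^sub>M R)))"
    by (rule nn_integral_drop_randomness[OF R meas, symmetric])
  also have "\<dots> \<le> (\<integral>\<^sup>+ (x, xs, r). ennreal ((norm (T *v (x - (\<Sum>i<n. k i (x, xs, r) *\<^sub>R xs i))))\<^sup>2
        + s * (\<Sum>i<n. (k i (x, xs, r))\<^sup>2) + s) \<partial>(design \<Otimes>\<^sub>M (PiM {..<n} (\<lambda>_. design) \<Otimes>\<^sub>M R)))"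
  proof (intro nn_integral_mono, clarify)
    fix x xs r
    have "T *v (x - (\<Sum>i<n. k i (x, xs, r) *\<^sub>R xs i)) = T *v x - (\<Sum>i<n. k i (x, xs, r) *\<^sub>R (T *v xs i))"
      by (simp add: matrix_vector_mult_diff_distrib linear_sum matrix_vector_mult_scaleR)
    then show "ennreal ((norm (s *\<^sub>R u x xs))\<^sup>2 + s * (\<Sum>i<n. ((T *v xs i) \<bullet> u x xs)\<^sup>2) + s) \<le>
      ennreal ((norm (T *v (x - (\<Sum>i<n. k i (x, xs, r) *\<^sub>R xs i))))\<^sup>2 + s * (\<Sum>i<n. (k i (x, xs, r))\<^sup>2) + s)"
      unfolding u_def using ridge_optimal[OF s] by (intro ennreal_leI add_right_mono) simp
  qed
  also have "\<dots> = (\<integral>\<^sup>+ \<theta>. lin_risk n P R l \<theta> \<partial>\<nu>)"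
    unfolding lk by (rule bayes_risk_eq[OF k R \<nu> T, symmetric]) simp
  finally show "enn2ereal (\<integral>\<^sup>+ x. (\<integral>\<^sup>+ xs. ennreal ((norm (s *\<^sub>R u x xs))\<^sup>2 + s * (\<Sum>i<n. ((T *v xs i) \<bullet> u x xs)\<^sup>2) + s)
      \<partial>PiM {..<n} (\<lambda>_. design)) \<partial>design) \<le> enn2ereal (\<integral>\<^sup>+ \<theta>. lin_risk n P (fst (R, l)) (snd (R, l)) \<theta> \<partial>\<nu>)"
    by (simp add: less_eq_ennreal.rep_eq)
qed

text \<open>Ridge weights with any positive regulariser \<open>r\<close> are a competitor in the
  noiseless problem. Their penalty is not charged there, so only the squared residual
  \<open>r *\<^sub>R u x xs\<close> remains. Taking \<open>r\<close> equal to the noise variance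
  matches the bias of the noisy optimum.\<close>

lemma Ebar_noiseless_le_ridge:
  fixes \<nu> :: "(real^'d) measure" and T :: "real^'d^'d" and Rty :: "'r itself" and n :: nat
  assumes \<nu>: "prob_space \<nu>" "sets \<nu> = sets borel"
    and T: "\<And>w. (\<integral>\<^sup>+ \<theta>. ennreal ((w \<bullet> \<theta>)\<^sup>2) \<partial>\<nu>) = ennreal ((norm (T *v w))\<^sup>2)"
    and s: "s = 0" and r: "r > 0"
  defines "u \<equiv> \<lambda>x xs. ridge_dual n r (\<lambda>i. T *v xs i) (T *v x)"
  shows "Ebar Rty n P \<nu> 0 \<le> enn2ereal (\<integral>\<^sup>+ x. (\<integral>\<^sup>+ xs. ennreal ((norm (r *\<^sub>R u x xs))\<^sup>2)
      \<partial>PiM {..<n} (\<lambda>_. design)) \<partial>design)"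
proof -
  \<comment> \<open>The competitor is deterministic; a point mass at an arbitrary element serves as
    its randomness space on the type \<open>'r\<close>.\<close>
  define R :: "'r measure" where "R = return (count_space UNIV) undefined"
  have R: "prob_space R"
    unfolding R_def by (rule prob_space_return) simp
  define l where "l i = (if i < n then (\<lambda>w :: (real^'d) \<times> (nat \<Rightarrow> real^'d) \<times> 'r. (T *v (fst (snd w) i)) \<bullet> u (fst w) (fst (snd w))) else (\<lambda>_. 0))" for i
  have um: "(\<lambda>p. u (fst p) (snd p)) \<in> borel_measurable (borel \<Otimes>\<^sub>M PiM {..<n} (\<lambda>_. borel))"
    unfolding u_def by (rule borel_measurable_ridge_dual) measurable
  have um': "(\<lambda>w. u (fst w) (fst (snd w))) \<in> borel_measurable (borel \<Otimes>\<^sub>M (PiM {..<n} (\<lambda>_. borel) \<Otimes>\<^sub>M R))"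
    unfolding u_def by (rule borel_measurable_ridge_dual) measurable
  have l: "l i \<in> borel_measurable (borel \<Otimes>\<^sub>M (PiM {..<n} (\<lambda>_. borel) \<Otimes>\<^sub>M R))" for i
    unfolding l_def using um' by (cases "i < n") simp_all
  have lr: "l \<in> linear_rules n R"
    using l by (simp add: linear_rules_def)
  have res: "T *v (x - (\<Sum>i<n. l i (x, xs, q) *\<^sub>R xs i)) = r *\<^sub>R u x xs" for x xs q
    using ridge_residual[OF r, of "T *v x" "\<lambda>i. T *v xs i" n]
    by (simp add: l_def u_def matrix_vector_mult_diff_distrib linear_sum matrix_vector_mult_scaleR)
  have meas: "(\<lambda>(x, xs). ennreal ((norm (r *\<^sub>R u x xs))\<^sup>2))
      \<in> borel_measurable (borel \<Otimes>\<^sub>M PiM {..<n} (\<lambda>_. borel))"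
    unfolding split_beta' using um by measurable
  have "(\<integral>\<^sup>+ \<theta>. lin_risk n P R l \<theta> \<partial>\<nu>) = (\<integral>\<^sup>+ (x, xs, q). ennreal ((norm (r *\<^sub>R u x xs))\<^sup>2)
      \<partial>(design \<Otimes>\<^sub>M (PiM {..<n} (\<lambda>_. design) \<Otimes>\<^sub>M R)))"
    by (subst bayes_risk_eq[OF l R \<nu> T]) (simp_all add: s res)
  also have "\<dots> = (\<integral>\<^sup>+ x. (\<integral>\<^sup>+ xs. ennreal ((norm (r *\<^sub>R u x xs))\<^sup>2) \<partial>PiM {..<n} (\<lambda>_. design)) \<partial>design)"
    by (rule nn_integral_drop_randomness[OF R meas])
  finally have eq: "(\<integral>\<^sup>+ \<theta>. lin_risk n P R l \<theta> \<partial>\<nu>) = \<dots>" .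
  have "(INF Rl \<in> {(R :: 'r measure, l). prob_space R \<and> l \<in> linear_rules n R}.
        enn2ereal (\<integral>\<^sup>+ \<theta>. lin_risk n P (fst Rl) (snd Rl) \<theta> \<partial>\<nu>)) \<le> enn2ereal (\<integral>\<^sup>+ \<theta>. lin_risk n P R l \<theta> \<partial>\<nu>)"
    by (rule INF_lower2[of "(R, l)"]) (use R lr in auto)
  then show ?thesis
    unfolding Ebar_def eq by (simp add: zero_ereal_def[symmetric])
qed

end

section \<open>The noiseless model and the lower bound for the gap\<close>

lemma
  fixes P :: "((real^'d) \<times> real) measure"
  assumes "noise_model P s"
  shows noise_model_noiseless: "noise_model (noiseless P) 0"
    and design_noiseless: "noise_model.design (noiseless P) = noise_model.design P"
proof -
  interpret noise_model P s by (rule assms)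
  have f[measurable]: "(\<lambda>z. (fst z, 0 :: real)) \<in> borel_measurable P"
    by (rule borel_measurable_Pair) auto
  have [measurable]: "(fst :: (real^'d) \<times> real \<Rightarrow> _) \<in> borel_measurable borel"
    "(snd :: (real^'d) \<times> real \<Rightarrow> _) \<in> borel_measurable borel"
    by (auto intro!: borel_measurable_continuous_onI continuous_intros)
  show *: "noise_model (noiseless P) 0"
    unfolding noiseless_def
  proof (rule noise_model.intro)
    show "prob_space (distr P borel (\<lambda>z. (fst z, 0 :: real)))"
      by (rule prob_space_distr) (rule f)
    show "integrable (distr P borel (\<lambda>z. (fst z, 0 :: real))) (\<lambda>z. (snd z)\<^sup>2)"
      by (simp add: integrable_distr_eq)
    fix B :: "(real^'d) set" assume [measurable]: "B \<in> sets borel"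
    show "(\<integral> z. indicator B (fst z) * snd z \<partial>distr P borel (\<lambda>z. (fst z, 0 :: real))) = 0"
      by (subst integral_distr) auto
    show "(\<integral> z. indicator B (fst z) * (snd z)\<^sup>2 \<partial>distr P borel (\<lambda>z. (fst z, 0 :: real))) =
        0 * (\<integral> z. indicator B (fst z) \<partial>distr P borel (\<lambda>z. (fst z, 0 :: real)))"
      by (subst integral_distr) auto
  qed auto
  \<comment> \<open>Removing the noise leaves the covariates untouched, so both Bayes risks become
    integrals over the same \<open>design\<close> and can be subtracted.\<close>
  show "noise_model.design (noiseless P) = noise_model.design P"
    unfolding noise_model.design_def[OF *] design_def
    unfolding noiseless_def by (subst distr_distr) (auto simp: comp_def)
qed

text \<open>The noisy value is at least \<open>Ib + s * Iv\<close> with \<open>Ib\<close> the ridge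
  bias and \<open>Iv\<close> the expected squared weights; the noiseless value is at most
  \<open>Ib\<close>. The bias cancels and \<open>Iv\<close> is bounded below by df2/n.\<close>

lemma (in noise_model) Ebar_noise_gap:
  fixes \<nu> :: "(real^'d) measure" and T S :: "real^'d^'d" and Rty :: "'r itself"
  assumes s: "s > 0" and n: "n \<ge> 1" and K0: "K \<ge> 0"
    and \<nu>: "prob_space \<nu>" "sets \<nu> = sets borel"
    and T: "\<And>w. (\<integral>\<^sup>+ \<theta>. ennreal ((w \<bullet> \<theta>)\<^sup>2) \<partial>\<nu>) = ennreal ((norm (T *v w))\<^sup>2)"
    and rv: "random_vector design (\<lambda>x. T *v x) S"
    and fourth: "\<And>v. integrable design (\<lambda>x. (norm (T *v x))\<^sup>2 * (v \<bullet> (T *v x))\<^sup>2)"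
    and K: "\<And>v. (\<integral> x. (norm (T *v x))\<^sup>2 * (v \<bullet> (T *v x))\<^sup>2 \<partial>design) \<le> K * (v \<bullet> (S *v v))"
  shows "ereal (s / real n * df2 S ((s + K) / real n)) \<le> Ebar Rty n P \<nu> s - Ebar Rty n (noiseless P) \<nu> 0"
proof -
  interpret RV: random_vector design "\<lambda>x. T *v x" S by (rule rv)
  let ?D = "PiM {..<n} (\<lambda>_. design)"
  interpret DI: prob_space ?D by (rule prob_space_PiM) (rule prob_space_design)
  interpret D2: pair_prob_space design ?D ..
  note N0 = noise_model_noiseless[OF noise_model_axioms]
  define u where "u x xs = ridge_dual n s (\<lambda>i. T *v xs i) (T *v x)" for x and xs :: "nat \<Rightarrow> real^'d"
  define b where "b x xs = (norm (s *\<^sub>R u x xs))\<^sup>2" for x xs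
  define v where "v x xs = (\<Sum>i<n. ((T *v xs i) \<bullet> u x xs)\<^sup>2)" for x xs
  have um: "(\<lambda>p. u (fst p) (snd p)) \<in> borel_measurable (borel \<Otimes>\<^sub>M PiM {..<n} (\<lambda>_. borel))"
    unfolding u_def by (rule borel_measurable_ridge_dual) measurable
  have bM: "(\<lambda>(x, xs). b x xs) \<in> borel_measurable (borel \<Otimes>\<^sub>M PiM {..<n} (\<lambda>_. borel))"
    and vM: "(\<lambda>(x, xs). v x xs) \<in> borel_measurable (borel \<Otimes>\<^sub>M PiM {..<n} (\<lambda>_. borel))"
    unfolding split_beta' b_def v_def using um by measurable
  note [measurable] = bM vM
  have b0: "0 \<le> b x xs" and v0: "0 \<le> v x xs" for x xs
    by (auto simp: b_def v_def intro: sum_nonneg)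
  define Ib where "Ib = (\<integral>\<^sup>+ x. (\<integral>\<^sup>+ xs. ennreal (b x xs) \<partial>?D) \<partial>design)"
  define Iv where "Iv = (\<integral>\<^sup>+ x. (\<integral>\<^sup>+ xs. ennreal (v x xs) \<partial>?D) \<partial>design)"
  have split: "(\<integral>\<^sup>+ x. (\<integral>\<^sup>+ xs. ennreal (b x xs + s * v x xs + s) \<partial>?D) \<partial>design) = Ib + ennreal s * Iv + ennreal s"
  proof -
    have "(\<integral>\<^sup>+ xs. ennreal (b x xs + s * v x xs + s) \<partial>?D) =
        (\<integral>\<^sup>+ xs. ennreal (b x xs) \<partial>?D) + ennreal s * (\<integral>\<^sup>+ xs. ennreal (v x xs) \<partial>?D) + ennreal s" for x
    proof -
      have [measurable]: "(\<lambda>xs. b x xs) \<in> borel_measurable ?D" "(\<lambda>xs. v x xs) \<in> borel_measurable ?D"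
        by measurable
      have "(\<integral>\<^sup>+ xs. ennreal (b x xs + s * v x xs + s) \<partial>?D) =
          (\<integral>\<^sup>+ xs. ennreal (b x xs) + ennreal s * ennreal (v x xs) + ennreal s \<partial>?D)"
        using b0 v0 s by (simp add: ennreal_mult ennreal_plus[symmetric] del: ennreal_plus flip: ennreal_mult)
      then show ?thesis
        by (simp add: nn_integral_add nn_integral_cmult DI.emeasure_space_1)
    qed
    then show ?thesis
      unfolding Ib_def Iv_def by (simp add: nn_integral_add nn_integral_cmult RV.emeasure_space_1)
  qed
  \<comment> \<open>Finiteness is what allows \<open>Ib\<close> to cancel in the extended reals. It
    follows by comparing ridge with zero weights, whose objective is the integrable squared norm of
    \<open>T *v x\<close>.\<close>
  have Ib_fin: "Ib < \<infinity>"
  proof -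
    have "b x xs \<le> (norm (T *v x))\<^sup>2" for x xs
    proof -
      have "b x xs + s * v x xs \<le> (norm (T *v x))\<^sup>2"
        using ridge_optimal[OF s, where n = n and Z = "\<lambda>i. T *v xs i" and y = "T *v x" and k = "\<lambda>_. 0"]
        by (simp add: b_def v_def u_def)
      moreover have "0 \<le> s * v x xs"
        using s v0 by simp
      ultimately show ?thesis by linarith
    qed
    then have "Ib \<le> (\<integral>\<^sup>+ x. (\<integral>\<^sup>+ xs. ennreal ((norm (T *v x))\<^sup>2) \<partial>?D) \<partial>design)"
      unfolding Ib_def by (intro nn_integral_mono ennreal_leI)
    also have "\<dots> = ennreal (\<integral> x. (norm (T *v x))\<^sup>2 \<partial>design)"
      using RV.Z_sq by (simp add: DI.emeasure_space_1 nn_integral_eq_integral)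
    also have "\<dots> < \<infinity>" by simp
    finally show ?thesis .
  qed
  then obtain B where B: "Ib = ennreal B" "B \<ge> 0"
    by (cases Ib) auto
  have Iv_ge: "ennreal (df2 S ((s + K) / real n) / real n) \<le> Iv"
  proof -
    obtain e d where e: "eigenbasis S e d"
      using eigenbasis_exists RV.psd_S unfolding psd_mat_def by metis
    \<comment> \<open>The test point is averaged first for a fixed sample; this turns
      \<open>Iv\<close> into the spectral sum of \<open>expected_ridge_weights\<close>.\<close>
    have "Iv = (\<integral>\<^sup>+ xs. (\<integral>\<^sup>+ x. ennreal (v x xs) \<partial>design) \<partial>?D)"
      unfolding Iv_def by (rule D2.Fubini'[symmetric]) measurable
    also have "\<dots> = (\<integral>\<^sup>+ xs. ennreal (\<Sum>j\<in>UNIV. d j * (\<Sum>i<n. ((T *v xs i) \<bullet> ridge_dual n s (\<lambda>i. T *v xs i) (e j))\<^sup>2)) \<partial>?D)"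
      unfolding v_def u_def RV.nn_integral_ridge_weights[OF e s] ..
    also have "\<dots> \<ge> ennreal (df2 S ((s + K) / real n) / real n)"
      using e by (intro RV.expected_ridge_weights[OF e fourth _ K0 s n] order_trans[OF K]) (auto simp: eigenbasis_def)
    finally show ?thesis .
  qed
  have df: "df2 S ((s + K) / real n) / real n \<ge> 0"
    using s n K0 by (intro divide_nonneg_nonneg df2_nonneg RV.psd_S) auto
  define g where "g = df2 S ((s + K) / real n) / real n"
  let ?q = "s * g"
  have g: "0 \<le> g" "ennreal g \<le> Iv"
    using df Iv_ge by (simp_all add: g_def)
  have "ennreal (B + ?q + s) = ennreal B + ennreal s * ennreal g + ennreal s"
    using s g(1) B(2) by (simp add: ennreal_mult)
  also have "\<dots> \<le> Ib + ennreal s * Iv + ennreal s"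
    unfolding B(1) using g(2) by (intro add_mono mult_left_mono order_refl) auto
  finally have "ennreal (B + ?q + s) \<le> Ib + ennreal s * Iv + ennreal s" .
  then have "ereal (B + ?q + s) \<le> enn2ereal (Ib + ennreal s * Iv + ennreal s)"
    using s g(1) B(2) unfolding less_eq_ennreal.rep_eq by (subst (asm) enn2ereal_ennreal) auto
  then have "ereal (B + ?q + s) - ereal s \<le> enn2ereal (Ib + ennreal s * Iv + ennreal s) - ereal s"
    by (intro ereal_minus_mono) auto
  also have "\<dots> \<le> Ebar Rty n P \<nu> s"
    using Ebar_ge_ridge[OF \<nu> T s, of n Rty] unfolding split[symmetric] b_def v_def u_def .
  finally have ge: "ereal (B + ?q) \<le> Ebar Rty n P \<nu> s" by simp
  have le: "Ebar Rty n (noiseless P) \<nu> 0 \<le> ereal B"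
    using noise_model.Ebar_noiseless_le_ridge[OF N0 \<nu> T refl s, of Rty n] B
    unfolding design_noiseless[OF noise_model_axioms] Ib_def b_def u_def by simp
  \<comment> \<open>The real number \<open>B\<close> bounds one value from below together with
    \<open>?q\<close> and the other from above, so monotonicity of extended subtraction isolates
    \<open>?q\<close>.\<close>
  have "ereal (B + ?q) - ereal B \<le> Ebar Rty n P \<nu> s - Ebar Rty n (noiseless P) \<nu> 0"
    by (rule ereal_minus_mono[OF ge le])
  moreover have "ereal (B + ?q) - ereal B = ereal (s / real n * df2 S ((s + K) / real n))"
    unfolding g_def ereal_minus(1) by simp
  ultimately show ?thesis by (simp only:)
qed

theorem theorem2:
  fixes P :: "((real^'d) \<times> real) measure"
    and \<nu> :: "(real^'d) measure"
    and A :: "real^'d^'d"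
    and n :: nat and \<sigma>2 L :: real
    and Rty :: "'r itself"
  defines "H \<equiv> (\<chi> i j. \<integral> \<theta>. \<theta> $ i * \<theta> $ j \<partial>\<nu>)"
  defines "\<Sigma> \<equiv> (\<chi> i j. \<integral> z. fst z $ i * fst z $ j \<partial>P)"
  defines "Xt \<equiv> (\<lambda>z. psd_sqrt H *v fst z)"
  defines "\<Sigma>H \<equiv> psd_sqrt H ** \<Sigma> ** psd_sqrt H"
  assumes n: "n \<ge> 1"
    and sigma: "\<sigma>2 > 0"
    and P_prob: "prob_space P" and P_sets: "sets P = sets borel"
    and X_sq: "integrable P (\<lambda>z. (norm (fst z))\<^sup>2)"
    and eps_sq: "integrable P (\<lambda>z. (snd z)\<^sup>2)"
    and eps_mean: "\<forall>B \<in> sets borel. (\<integral> z. indicator B (fst z) * snd z \<partial>P) = 0"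
    and eps_var: "\<forall>B \<in> sets borel.
        (\<integral> z. indicator B (fst z) * (snd z)\<^sup>2 \<partial>P) = \<sigma>2 * (\<integral> z. indicator B (fst z) \<partial>P)"
    and nu_prob: "prob_space \<nu>" and nu_sets: "sets \<nu> = sets borel"
    and A_psd: "psd_mat A"
    and nu_supp: "AE \<theta> in \<nu>. norm (A *v \<theta>) = 1"
    and nu_sq: "integrable \<nu> (\<lambda>\<theta>. (norm \<theta>)\<^sup>2)"
    and L_pos: "L > 0"
    and fourth: "\<forall>i j. integrable P (\<lambda>z. (norm (Xt z))\<^sup>2 * Xt z $ i * Xt z $ j)"
    and moment: "loewner_le (\<chi> i j. \<integral> z. (norm (Xt z))\<^sup>2 * Xt z $ i * Xt z $ j \<partial>P)
                            (L\<^sup>2 *\<^sub>R \<Sigma>H)"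
  shows "(L\<^sup>2 < \<sigma>2 \<longrightarrow>
            ereal ((1 - L\<^sup>2 / \<sigma>2) * (\<sigma>2 / real n) * df2 \<Sigma>H ((\<sigma>2 + L\<^sup>2) / real n))
              \<le> Ebar Rty n P \<nu> \<sigma>2 - Ebar Rty n (noiseless P) \<nu> 0)
       \<and> ((AE z in P. (norm (Xt z))\<^sup>2 \<le> L\<^sup>2) \<longrightarrow>
            ereal ((1 / (1 + L\<^sup>2 / \<sigma>2)\<^sup>2) * (\<sigma>2 / real n) * df2 \<Sigma>H (\<sigma>2 / real n))
              \<le> Ebar Rty n P \<nu> \<sigma>2 - Ebar Rty n (noiseless P) \<nu> 0)"
proof -
  interpret NM: noise_model P \<sigma>2
    using P_prob P_sets eps_sq eps_mean eps_var sigma by (auto simp: noise_model_def)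
  interpret V: random_vector \<nu> "\<lambda>\<theta>. \<theta>" H
    using nu_prob nu_sq
    by (auto simp: random_vector_def random_vector_axioms_def H_def measurable_cong_sets[OF nu_sets refl])
  define T where "T = psd_sqrt H"
  have T: "psd_mat T" "T ** T = H"
    using psd_sqrt[OF V.psd_S] by (auto simp: T_def)
  have Tsym: "transpose T = T"
    using T(1) by (simp add: psd_mat_def)
  \<comment> \<open>The prior enters only through its second moment: w . H w is the squared length
    of H^(1/2) w. Hence the bias is measured in the transformed vectors.\<close>
  have Q: "(\<integral>\<^sup>+ \<theta>. ennreal ((w \<bullet> \<theta>)\<^sup>2) \<partial>\<nu>) = ennreal ((norm (T *v w))\<^sup>2)" for w
  proof -
    have "w \<bullet> (H *v w) = (norm (T *v w))\<^sup>2"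
      unfolding T(2)[symmetric] power2_norm_eq_inner matrix_vector_mul_assoc[symmetric]
      by (rule symmetric_matrix_inner[OF Tsym])
    then show ?thesis
      using V.nn_integral_inner_square[of w] by simp
  qed
  have Xt: "Xt z = T *v fst z" for z
    by (simp add: Xt_def T_def)
  interpret RX: random_vector P fst \<Sigma>
    using P_prob X_sq by (auto simp: random_vector_def random_vector_axioms_def \<Sigma>_def)
  have SH: "\<Sigma>H = T ** \<Sigma> ** T"
    by (simp add: \<Sigma>H_def T_def)
  interpret RT: random_vector P "\<lambda>z. T *v fst z" \<Sigma>H
    unfolding SH by (rule random_vector_matrix_image[OF RX.random_vector_axioms Tsym])
  have rv: "random_vector NM.design (\<lambda>x. T *v x) \<Sigma>H"
    using NM.prob_space_design RT.Z_sq RT.S_def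
    by (auto simp: random_vector_def random_vector_axioms_def NM.design_def integrable_distr_eq integral_distr)
  have expand: "(norm (Xt z))\<^sup>2 * (v \<bullet> Xt z)\<^sup>2 =
      (\<Sum>i\<in>UNIV. \<Sum>j\<in>UNIV. v $ i * v $ j * ((norm (Xt z))\<^sup>2 * Xt z $ i * Xt z $ j))" for v z
    by (simp add: inner_vec_def power2_eq_square sum_product sum_distrib_left mult_ac)
  have fourth_P: "integrable P (\<lambda>z. (norm (Xt z))\<^sup>2 * (v \<bullet> Xt z)\<^sup>2)" for v
    unfolding expand using fourth by simp
  let ?M = "\<chi> i j. \<integral> z. (norm (Xt z))\<^sup>2 * Xt z $ i * Xt z $ j \<partial>P"
  \<comment> \<open>The Loewner inequality is tested on a single vector: the quadratic form of
    \<open>?M\<close> at \<open>v\<close> is the mixed fourth moment in direction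
    \<open>v\<close>.\<close>
  have moment_P: "(\<integral> z. (norm (Xt z))\<^sup>2 * (v \<bullet> Xt z)\<^sup>2 \<partial>P) \<le> L\<^sup>2 * (v \<bullet> (\<Sigma>H *v v))" for v
  proof -
    have "(\<integral> z. (norm (Xt z))\<^sup>2 * (v \<bullet> Xt z)\<^sup>2 \<partial>P) = v \<bullet> (?M *v v)"
      unfolding expand using fourth
      by (simp add: inner_vec_def matrix_vector_mult_def sum_distrib_left mult_ac)
    moreover have "0 \<le> v \<bullet> ((L\<^sup>2 *\<^sub>R \<Sigma>H - ?M) *v v)"
      using moment by (simp add: loewner_le_def psd_mat_def)
    ultimately show ?thesis
      by (simp add: matrix_vector_mult_diff_rdistrib inner_diff_right scaleR_matrix_vector_assoc[symmetric])
  qed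
  have fourth_D: "integrable NM.design (\<lambda>x. (norm (T *v x))\<^sup>2 * (v \<bullet> (T *v x))\<^sup>2)" for v
    using fourth_P[of v] unfolding NM.design_def Xt by (subst integrable_distr_eq) auto
  have moment_D: "(\<integral> x. (norm (T *v x))\<^sup>2 * (v \<bullet> (T *v x))\<^sup>2 \<partial>NM.design) \<le> L\<^sup>2 * (v \<bullet> (\<Sigma>H *v v))" for v
    using moment_P[of v] unfolding NM.design_def Xt by (subst integral_distr) auto
  \<comment> \<open>One bound with constant 1 and \<lambda> = (\<sigma>^2 + L^2)/n yields both
    parts: the first by decreasing the constant to 1 - L^2/\<sigma>^2, the second by changing
    \<lambda>.\<close>
  have gap: "ereal (\<sigma>2 / real n * df2 \<Sigma>H ((\<sigma>2 + L\<^sup>2) / real n))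
      \<le> Ebar Rty n P \<nu> \<sigma>2 - Ebar Rty n (noiseless P) \<nu> 0"
    by (rule NM.Ebar_noise_gap[OF sigma n _ nu_prob nu_sets Q rv fourth_D moment_D]) simp
  have npos: "real n > 0"
    using n by simp
  have df: "0 \<le> df2 \<Sigma>H ((\<sigma>2 + L\<^sup>2) / real n)"
    using sigma npos by (intro df2_nonneg RT.psd_S divide_pos_pos add_pos_nonneg) auto
  have "(1 - L\<^sup>2 / \<sigma>2) * (\<sigma>2 / real n) * df2 \<Sigma>H ((\<sigma>2 + L\<^sup>2) / real n)
      \<le> \<sigma>2 / real n * df2 \<Sigma>H ((\<sigma>2 + L\<^sup>2) / real n)"
    using sigma npos mult_right_mono[OF _ mult_nonneg_nonneg[OF _ df], of "1 - L\<^sup>2 / \<sigma>2" 1 "\<sigma>2 / real n"] by (simp add: mult.assoc)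
  moreover have "(1 / (1 + L\<^sup>2 / \<sigma>2)\<^sup>2) * (\<sigma>2 / real n) * df2 \<Sigma>H (\<sigma>2 / real n)
      \<le> \<sigma>2 / real n * df2 \<Sigma>H ((\<sigma>2 + L\<^sup>2) / real n)"
  proof -
    \<comment> \<open>Identifies the parameter of \<open>gap\<close> as \<sigma>^2/n enlarged by the
      factor 1 + L^2/\<sigma>^2, the form required by \<open>df2_shift_le\<close>.\<close>
    have "\<sigma>2 / real n * (1 + L\<^sup>2 / \<sigma>2) = (\<sigma>2 + L\<^sup>2) / real n"
      using sigma by (simp add: distrib_left add_divide_distrib)
    then have "1 / (1 + L\<^sup>2 / \<sigma>2)\<^sup>2 * df2 \<Sigma>H (\<sigma>2 / real n) \<le> df2 \<Sigma>H ((\<sigma>2 + L\<^sup>2) / real n)"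
      using df2_shift_le[OF RT.psd_S, of "\<sigma>2 / real n" "L\<^sup>2 / \<sigma>2"] sigma npos by simp
    then have "\<sigma>2 / real n * (1 / (1 + L\<^sup>2 / \<sigma>2)\<^sup>2 * df2 \<Sigma>H (\<sigma>2 / real n)) \<le> \<sigma>2 / real n * df2 \<Sigma>H ((\<sigma>2 + L\<^sup>2) / real n)"
      using sigma npos by (intro mult_left_mono) auto
    then show ?thesis
      by (simp add: mult_ac)
  qed
  ultimately show ?thesis
    using gap by (meson ereal_less_eq(3) order_trans)
qed

end
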